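(* Let $G=\mathbb{Z}_p^r\rtimes\mathbb{Z}_{p^r-1}$ (the Frobenius group with Frobenius kernel $\mathbb{Z}_p^r$ and Frobenius complement $\mathbb{Z}_{p^r-1}$) for some prime $p$ and $r\ge 1$. Suppose $C_0=\{e\},C_1,\dots,C_{p^r-1}$ are the conjugacy classes of $G$. Then the Wedderburn decomposition of $T(G)$ is $$T(G)\cong V\oplus W_1\oplus W_2\oplus\cdots\oplus W_{p^r-1},$$ where $V$ is the primary component, each $W_i=\mathrm{Span}(B_i)$, and the idempotent $B_i$ is defined to be the $|G|\times|G|$ matrix indexed by $G$ which is $0$ outside the $C_i,C_i$ block and has $C_i,C_i$ block $$d_{ii}=\frac{-1}{|C_i|-1}J_{|C_i|}+\left(1-\frac{-1}{|C_i|-1}\right)I_{|C_i|},$$ i.e. the matrix with all diagonal entries $1$ and all off-diagonal entries $\frac{-1}{|C_i|-1}$.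
   Context: $J_m$ and $I_m$ are the $m\times m$ all-ones and identity matrices, and spans are over $\mathbb{C}$. For a finite group $G$ with conjugacy classes $C_0=\{e\},C_1,\dots,C_d$, let $A_i$ be the $G\times G$ matrix with $(A_i)_{xy}=1$ if $yx^{-1}\in C_i$, and $0$ otherwise, and let $E_i^*$ be the diagonal matrix with $(E_i^* )_{yy}=1$ if $y\in C_i$ and $0$ otherwise. $T(G)$ is the subalgebra of $M_{|G|}(\mathbb{C})$ generated by all $A_i$ and $E_i^*$ (the Terwilliger algebra of the group association scheme with base point $e$). It is semisimple; its Wedderburn decomposition is its decomposition as the direct sum of its minimal two-sided ideals. The primary component $V$ is the minimal two-sided ideal of dimension $(d+1)^2$ acting nontrivially on the irreducible module $\mathrm{Span}\{A_0,\dots,A_d\}\hat{e}\subseteq\mathbb{C}^{|G|}$, where $\hat{e}$ is the standard basis vector at $e$. The $C_i,C_i$ block of a matrix indexed by $G$ is the submatrix with rows and columns indexed by $C_i$.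
   Formalization: The case p^r = 2, where the complement is trivial and d_11 is undefined, is excluded; and B_i is not asserted to be idempotent, since with the displayed d_ii one has B_i^2 = (|C_i|/(|C_i|-1)) B_i, so it is idempotent only up to scaling. *)

theory Defs
  imports
    Complex_Main
    "HOL-Library.Function_Algebras"
    "HOL-Computational_Algebra.Primes"
    "HOL-Algebra.Product_Groups"
    "HOL-Algebra.Group_Action"
    "HOL-Algebra.Subrings"
begin

section \<open>Frobenius groups\<close>

definition conj_set :: "('a, 'b) monoid_scheme \<Rightarrow> 'a \<Rightarrow> 'a set \<Rightarrow> 'a set" where
  "conj_set G g H = (\<lambda>h. g \<otimes>\<^bsub>G\<^esub> h \<otimes>\<^bsub>G\<^esub> inv\<^bsub>G\<^esub> g) ` H"

definition frobenius_complement :: "('a, 'b) monoid_scheme \<Rightarrow> 'a set \<Rightarrow> bool" where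
  "frobenius_complement G H \<longleftrightarrow>
     subgroup H G \<and> H \<noteq> {\<one>\<^bsub>G\<^esub>} \<and> H \<noteq> carrier G \<and>
     (\<forall>g \<in> carrier G - H. H \<inter> conj_set G g H = {\<one>\<^bsub>G\<^esub>})"

definition frobenius_kernel :: "('a, 'b) monoid_scheme \<Rightarrow> 'a set \<Rightarrow> 'a set" where
  "frobenius_kernel G H =
     insert \<one>\<^bsub>G\<^esub> (carrier G - (\<Union>g \<in> carrier G. conj_set G g H))"

definition internal_semidirect_product ::
    "('a, 'b) monoid_scheme \<Rightarrow> 'a set \<Rightarrow> 'a set \<Rightarrow> bool" where
  "internal_semidirect_product G N H \<longleftrightarrow>
     N \<lhd> G \<and> subgroup H G \<and> N \<inter> H = {\<one>\<^bsub>G\<^esub>} \<and> N <#>\<^bsub>G\<^esub> H = carrier G"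

text \<open>The complement is required to be nontrivial, so a group of order 2 is not a Frobenius
  group.\<close>

definition frobenius_group ::
    "('a, 'b) monoid_scheme \<Rightarrow> 'a set \<Rightarrow> 'a set \<Rightarrow> bool" where
  "frobenius_group G N H \<longleftrightarrow>
     group G \<and> finite (carrier G) \<and> frobenius_complement G H \<and>
     N = frobenius_kernel G H \<and> internal_semidirect_product G N H"

definition conjugacy_classes :: "('a, 'b) monoid_scheme \<Rightarrow> 'a set set" where
  "conjugacy_classes G =
     orbits G (carrier G) (\<lambda>g. \<lambda>h \<in> carrier G. g \<otimes>\<^bsub>G\<^esub> h \<otimes>\<^bsub>G\<^esub> inv\<^bsub>G\<^esub> g)"


section \<open>Complex matrices indexed by a set\<close>

text \<open>An \<open>X \<times> X\<close> matrix is a function of two arguments that vanishes outside \<open>X \<times> X\<close>.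
  Addition and zero are the pointwise ones.\<close>

type_synonym 'a cmatrix = "'a \<Rightarrow> 'a \<Rightarrow> complex"

definition mat_scale :: "complex \<Rightarrow> 'a cmatrix \<Rightarrow> 'a cmatrix" where
  "mat_scale c A = (\<lambda>x y. c * A x y)"

global_interpretation cmat: vector_space mat_scale
  by unfold_locales (auto simp: mat_scale_def fun_eq_iff algebra_simps)

definition mat_mult :: "'a set \<Rightarrow> 'a cmatrix \<Rightarrow> 'a cmatrix \<Rightarrow> 'a cmatrix" where
  "mat_mult X A B = (\<lambda>x y. \<Sum>z\<in>X. A x z * B z y)"

definition mat_vec :: "'a set \<Rightarrow> 'a cmatrix \<Rightarrow> ('a \<Rightarrow> complex) \<Rightarrow> 'a \<Rightarrow> complex" where
  "mat_vec X A v = (\<lambda>x. \<Sum>y\<in>X. A x y * v y)"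

definition std_basis :: "'a \<Rightarrow> 'a \<Rightarrow> complex" where
  "std_basis a = (\<lambda>x. if x = a then 1 else 0)"

definition matrix_algebra :: "'a set \<Rightarrow> 'a cmatrix ring" where
  "matrix_algebra X =
     \<lparr>carrier = {A. \<forall>x y. A x y \<noteq> 0 \<longrightarrow> x \<in> X \<and> y \<in> X},
      monoid.mult = mat_mult X,
      one = (\<lambda>x y. if x = y \<and> x \<in> X then 1 else 0),
      zero = 0,
      add = (+)\<rparr>"

definition generated_subalgebra :: "'a set \<Rightarrow> 'a cmatrix set \<Rightarrow> 'a cmatrix ring" where
  "generated_subalgebra X S =
     (matrix_algebra X)
       \<lparr>carrier := \<Inter>{B. subring B (matrix_algebra X) \<and> cmat.subspace B \<and> S \<subseteq> B}\<rparr>"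


section \<open>Wedderburn decompositions\<close>

text \<open>In an algebra with identity, every ring ideal is a linear subspace, so the ideals of the
  ring are the ideals of the algebra.\<close>

definition minimal_ideal :: "'a set \<Rightarrow> ('a, 'b) ring_scheme \<Rightarrow> bool" where
  "minimal_ideal I R \<longleftrightarrow>
     ideal I R \<and> I \<noteq> {\<zero>\<^bsub>R\<^esub>} \<and>
     (\<forall>J. ideal J R \<and> J \<subseteq> I \<longrightarrow> J = {\<zero>\<^bsub>R\<^esub>} \<or> J = I)"

text \<open>The family \<open>F\<close> lists every minimal two-sided ideal exactly once, and \<open>R\<close> is their
  internal direct sum.\<close>

definition wedderburn_decomposition ::
    "('a, 'b) ring_scheme \<Rightarrow> 'i set \<Rightarrow> ('i \<Rightarrow> 'a set) \<Rightarrow> bool" where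
  "wedderburn_decomposition R I F \<longleftrightarrow>
     finite I \<and>
     bij_betw F I {J. minimal_ideal J R} \<and>
     (\<forall>a \<in> carrier R. \<exists>!f. f \<in> (\<Pi>\<^sub>E i\<in>I. F i) \<and> finsum R f I = a)"


section \<open>The Terwilliger algebra of a group association scheme\<close>

definition adj_matrix :: "('a, 'b) monoid_scheme \<Rightarrow> 'a set \<Rightarrow> 'a cmatrix" where
  "adj_matrix G c =
     (\<lambda>x y. if x \<in> carrier G \<and> y \<in> carrier G \<and> y \<otimes>\<^bsub>G\<^esub> inv\<^bsub>G\<^esub> x \<in> c then 1 else 0)"

definition dual_idempotent :: "'a set \<Rightarrow> 'a cmatrix" where
  "dual_idempotent c = (\<lambda>x y. if x = y \<and> y \<in> c then 1 else 0)"

definition terwilliger_algebra :: "('a, 'b) monoid_scheme \<Rightarrow> 'a cmatrix ring" where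
  "terwilliger_algebra G =
     generated_subalgebra (carrier G)
       (adj_matrix G ` conjugacy_classes G \<union> dual_idempotent ` conjugacy_classes G)"

definition primary_module :: "('a, 'b) monoid_scheme \<Rightarrow> ('a \<Rightarrow> complex) set" where
  "primary_module G =
     (\<lambda>A. mat_vec (carrier G) A (std_basis \<one>\<^bsub>G\<^esub>)) `
       cmat.span (adj_matrix G ` conjugacy_classes G)"

text \<open>With classes \<open>C\<^sub>0, \<dots>, C\<^sub>d\<close>, the number of classes is \<open>d + 1\<close>.\<close>

definition is_primary_component :: "('a, 'b) monoid_scheme \<Rightarrow> 'a cmatrix set \<Rightarrow> bool" where
  "is_primary_component G V \<longleftrightarrow>
     minimal_ideal V (terwilliger_algebra G) \<and>
     cmat.dim V = (card (conjugacy_classes G))\<^sup>2 \<and>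
     (\<exists>A \<in> V. \<exists>v \<in> primary_module G. mat_vec (carrier G) A v \<noteq> 0)"

text \<open>With \<open>n = card c > 1\<close>, this matrix squares to \<open>n / (n - 1)\<close> times itself, so it is idempotent
  only up to a scalar; its span does not depend on the scaling.\<close>

definition class_matrix :: "'a set \<Rightarrow> 'a cmatrix" where
  "class_matrix c =
     (let \<alpha> = - 1 / (of_nat (card c) - 1) in
      (\<lambda>x y. if x \<in> c \<and> y \<in> c then \<alpha> * 1 + (1 - \<alpha>) * (if x = y then 1 else 0) else 0))"

end

theory Submission
  imports Defs "HOL-Library.Disjoint_Sets"
begin

text \<open>Let \<open>q = p ^ r\<close>, so that \<open>N\<close> has \<open>q\<close> elements and the complement \<open>H\<close> is abelian with \<open>q - 1\<close>
  elements. The proof has a group-theoretic half and a linear-algebra half, joined by one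
  combinatorial property of the conjugacy classes.

  An element of \<open>G\<close> that commutes with some non-identity element of \<open>H\<close> lies in \<open>H\<close>. So \<open>N\<close> acts freely
  by conjugation on the \<open>N\<close>-coset of every \<open>h \<noteq> \<one>\<close> in \<open>H\<close>, and \<open>H\<close> acts freely by conjugation
  on \<open>N - {\<one>}\<close>. In both cases the set acted on is exactly as large as the acting group, so
  both actions are transitive: two non-identity elements in the same coset of \<open>N\<close> are conjugate
  (\<open>conjugate_in_coset\<close>). Conversely conjugate elements lie in the same coset, because
  \<open>G Mod N\<close> is abelian. For \<open>x \<noteq> y\<close> the class of \<open>y \<otimes> inv x\<close> is therefore determined by
  its coset, hence by the classes of \<open>x\<close> and \<open>y\<close>. This is the assumption \<open>quotient_class\<close> of the
  locale \<open>class_partition\<close>.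

  Given that property, every adjacency matrix is constant on each off-diagonal class block
  and, on each diagonal block, constant off the diagonal and constant on it. Conversely,
  cutting a suitable adjacency matrix down to a block with dual idempotents gives an all-ones block,
  up to the identity of the block. So \<open>T(G)\<close> is spanned by the all-ones blocks and the identities of the
  classes (\<open>terwilliger_algebra_eq\<close>).

  The decomposition of such an algebra needs only the partition of the index set into a
  singleton and parts with at least two elements. The all-ones blocks multiply like matrix
  units up to nonzero scalars, so their span is an ideal, which is the primary component.
  The matrix \<open>class_matrix c\<close> is a multiple of the projection to the vectors on \<open>c\<close> with coordinate
  sum zero; its row and column sums vanish, so it annihilates all-ones blocks and every matrix of
  the algebra acts on it as a scalar. Multiplying a nonzero element of an ideal
  by these matrices shows that the ideal contains one of the
  listed components (\<open>nonzero_ideal_contains_component\<close>), which makes them exactly the minimal ideals.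
  The coefficients of a matrix along the \<open>class_matrix\<close> lines are read off from the difference
  between a diagonal and an off-diagonal entry of each diagonal block, which gives the
  direct sum (\<open>component_sum_unique\<close>).\<close>

section \<open>The full matrix algebra, its subalgebras and their ideals\<close>

lemma sum_cmatrix_apply: "(\<Sum>i\<in>S. M i) x y = (\<Sum>i\<in>S. (M i :: 'a cmatrix) x y)"
  by (induction S rule: infinite_finite_induct) auto

lemma matrix_algebra_simps:
  "carrier (matrix_algebra X) = {A. \<forall>x y. A x y \<noteq> 0 \<longrightarrow> x \<in> X \<and> y \<in> X}"
  "a \<otimes>\<^bsub>matrix_algebra X\<^esub> b = mat_mult X a b"
  "\<one>\<^bsub>matrix_algebra X\<^esub> = (\<lambda>x y. if x = y \<and> x \<in> X then 1 else 0)"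
  "\<zero>\<^bsub>matrix_algebra X\<^esub> = 0"
  "a \<oplus>\<^bsub>matrix_algebra X\<^esub> b = a + b"
  by (auto simp: matrix_algebra_def)

lemma mat_mult_assoc: "mat_mult X (mat_mult X a b) c = mat_mult X a (mat_mult X b c)"
proof (intro ext)
  fix x y
  have "mat_mult X (mat_mult X a b) c x y = (\<Sum>z\<in>X. \<Sum>w\<in>X. a x w * b w z * c z y)"
    by (simp add: mat_mult_def sum_distrib_right)
  also have "\<dots> = (\<Sum>w\<in>X. \<Sum>z\<in>X. a x w * b w z * c z y)"
    by (rule sum.swap)
  also have "\<dots> = mat_mult X a (mat_mult X b c) x y"
    by (simp add: mat_mult_def sum_distrib_left mult.assoc)
  finally show "mat_mult X (mat_mult X a b) c x y = mat_mult X a (mat_mult X b c) x y" .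
qed

lemma mat_mult_distrib:
  "mat_mult X (a + b) c = mat_mult X a c + mat_mult X b c"
  "mat_mult X c (a + b) = mat_mult X c a + mat_mult X c b"
  by (auto simp: mat_mult_def fun_eq_iff algebra_simps sum.distrib)

lemma mat_mult_scale:
  "mat_mult X (mat_scale k a) c = mat_scale k (mat_mult X a c)"
  "mat_mult X a (mat_scale k c) = mat_scale k (mat_mult X a c)"
  by (auto simp: mat_mult_def mat_scale_def fun_eq_iff algebra_simps sum_distrib_left)

lemma mat_mult_one:
  assumes "finite X" "a \<in> carrier (matrix_algebra X)"
  shows "mat_mult X (\<one>\<^bsub>matrix_algebra X\<^esub>) a = a" "mat_mult X a (\<one>\<^bsub>matrix_algebra X\<^esub>) = a"
proof -
  have left: "(if x = z \<and> x \<in> X then 1 else 0) * w = (if z = x then if x \<in> X then w else 0 else 0)"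
    and right: "w * (if z = x \<and> z \<in> X then 1 else 0) = (if z = x then if x \<in> X then w else 0 else 0)"
    for x z :: 'a and w :: complex by auto
  show "mat_mult X (\<one>\<^bsub>matrix_algebra X\<^esub>) a = a" "mat_mult X a (\<one>\<^bsub>matrix_algebra X\<^esub>) = a"
    unfolding mat_mult_def matrix_algebra_simps left right
    using assms by (auto simp: matrix_algebra_simps fun_eq_iff)
qed

lemma mat_mult_closed:
  assumes "a \<in> carrier (matrix_algebra X)" "b \<in> carrier (matrix_algebra X)"
  shows "mat_mult X a b \<in> carrier (matrix_algebra X)"
proof -
  have "mat_mult X a b x y = 0" if "\<not> (x \<in> X \<and> y \<in> X)" for x y
    unfolding mat_mult_def using that assms
    by (intro sum.neutral) (auto simp: matrix_algebra_simps)
  then show ?thesis by (auto simp: matrix_algebra_simps)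
qed

lemma ring_matrix_algebra:
  assumes "finite X" shows "ring (matrix_algebra X)"
proof (rule ringI)
  show "abelian_group (matrix_algebra X)"
  proof (rule abelian_groupI)
    fix a :: "'a cmatrix" assume "a \<in> carrier (matrix_algebra X)"
    then have "- a \<in> carrier (matrix_algebra X)" "- a \<oplus>\<^bsub>matrix_algebra X\<^esub> a = \<zero>\<^bsub>matrix_algebra X\<^esub>"
      by (auto simp: matrix_algebra_simps fun_eq_iff)
    then show "\<exists>b\<in>carrier (matrix_algebra X). b \<oplus>\<^bsub>matrix_algebra X\<^esub> a = \<zero>\<^bsub>matrix_algebra X\<^esub>"
      by blast
  next
    fix a b :: "'a cmatrix"
    assume "a \<in> carrier (matrix_algebra X)" "b \<in> carrier (matrix_algebra X)"
    then show "a \<oplus>\<^bsub>matrix_algebra X\<^esub> b \<in> carrier (matrix_algebra X)"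
      by (simp add: matrix_algebra_simps) (metis add.right_neutral)
  qed (simp_all add: matrix_algebra_simps add.assoc add.commute)
  show "monoid (matrix_algebra X)"
  proof (rule monoidI)
    show "\<one>\<^bsub>matrix_algebra X\<^esub> \<in> carrier (matrix_algebra X)"
      by (auto simp: matrix_algebra_simps)
  qed (simp_all add: mat_mult_closed mat_mult_one[OF assms] mat_mult_assoc matrix_algebra_simps(2))
qed (simp_all add: matrix_algebra_simps(2,5) mat_mult_distrib)

lemma a_inv_matrix_algebra:
  assumes "finite X" "a \<in> carrier (matrix_algebra X)"
  shows "\<ominus>\<^bsub>matrix_algebra X\<^esub> a = mat_scale (- 1) a"
proof -
  interpret ring "matrix_algebra X" using assms(1) by (rule ring_matrix_algebra)
  have "mat_scale (- 1) a \<in> carrier (matrix_algebra X)"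
    "mat_scale (- 1) a \<oplus>\<^bsub>matrix_algebra X\<^esub> a = \<zero>\<^bsub>matrix_algebra X\<^esub>"
    using assms(2) by (auto simp: matrix_algebra_simps fun_eq_iff mat_scale_def)
  then show ?thesis using assms(2) minus_equality by blast
qed

lemma subring_matrix_algebraI:
  assumes "finite X" "cmat.subspace B" "B \<subseteq> carrier (matrix_algebra X)"
    "\<one>\<^bsub>matrix_algebra X\<^esub> \<in> B" "\<And>a b. a \<in> B \<Longrightarrow> b \<in> B \<Longrightarrow> mat_mult X a b \<in> B"
  shows "subring B (matrix_algebra X)"
proof -
  interpret ring "matrix_algebra X" using assms(1) by (rule ring_matrix_algebra)
  show ?thesis
  proof (rule subringI)
    show "\<ominus>\<^bsub>matrix_algebra X\<^esub> h \<in> B" if "h \<in> B" for h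
    proof -
      have "h \<in> carrier (matrix_algebra X)" using that assms(3) by blast
      then show ?thesis
        using that assms(1,2) cmat.subspace_scale[of B h "- 1"] a_inv_matrix_algebra[of X h] by simp
    qed
  qed (use assms in \<open>auto simp: matrix_algebra_simps(2,5) cmat.subspace_add\<close>)
qed

lemma ring_subalgebra:
  assumes "finite X" "subring B (matrix_algebra X)"
  shows "ring ((matrix_algebra X)\<lparr>carrier := B\<rparr>)"
  using ring.subring_is_ring[OF ring_matrix_algebra[OF assms(1)] assms(2)] .

text \<open>An ideal is closed under scalars since the scalar multiples of the identity matrix belong to the
  subalgebra. This turns ideals into subspaces, for which spans and scaling are available.\<close>
lemma ideal_subalgebra_iff:
  assumes X: "finite X" and B: "subring B (matrix_algebra X)" "cmat.subspace B"
  shows "ideal K ((matrix_algebra X)\<lparr>carrier := B\<rparr>) \<longleftrightarrow>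
    cmat.subspace K \<and> K \<subseteq> B \<and> (\<forall>a\<in>K. \<forall>x\<in>B. mat_mult X x a \<in> K \<and> mat_mult X a x \<in> K)"
    (is "?L \<longleftrightarrow> ?R")
proof
  assume ?L
  then interpret ideal K "(matrix_algebra X)\<lparr>carrier := B\<rparr>" .
  have KB: "K \<subseteq> B" using a_subset by simp
  have mult: "mat_mult X x a \<in> K" "mat_mult X a x \<in> K" if "a \<in> K" "x \<in> B" for a x
    using that I_l_closed[of a x] I_r_closed[of a x] by (simp_all add: matrix_algebra_simps)
  have scale: "mat_scale c a \<in> K" if "a \<in> K" for c a
  proof -
    have a: "a \<in> carrier (matrix_algebra X)"
      using that KB subringE(1)[OF B(1)] by blast
    have "mat_scale c (\<one>\<^bsub>matrix_algebra X\<^esub>) \<in> B"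
      using subringE(3)[OF B(1)] B(2) cmat.subspace_scale by blast
    then have "mat_mult X (mat_scale c (\<one>\<^bsub>matrix_algebra X\<^esub>)) a \<in> K"
      using mult that by blast
    then show ?thesis
      by (simp add: mat_mult_scale mat_mult_one[OF X a])
  qed
  have "cmat.subspace K"
    unfolding cmat.subspace_def
    using scale additive_subgroup.zero_closed[OF additive_subgroup_axioms]
      additive_subgroup.a_closed[OF additive_subgroup_axioms] by (auto simp: matrix_algebra_simps)
  then show ?R using KB mult by blast
next
  assume R: ?R
  let ?A = "(matrix_algebra X)\<lparr>carrier := B\<rparr>"
  interpret ring ?A using X B(1) by (rule ring_subalgebra)
  show ?L
  proof (rule idealI)
    show "subgroup K (add_monoid ?A)"
    proof (rule add.subgroupI)
      show "K \<noteq> {}" using R cmat.subspace_0 by blast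
    next
      fix a assume a: "a \<in> K"
      have s: "mat_scale (- 1) a \<in> K" "mat_scale (- 1) a \<in> B"
        using a R cmat.subspace_scale by blast+
      have "mat_scale (- 1) a \<oplus>\<^bsub>?A\<^esub> a = \<zero>\<^bsub>?A\<^esub>"
        by (auto simp: matrix_algebra_simps mat_scale_def fun_eq_iff)
      then have "\<ominus>\<^bsub>?A\<^esub> a = mat_scale (- 1) a"
        using s a R minus_equality[of "mat_scale (- 1) a" a] by auto
      then show "\<ominus>\<^bsub>?A\<^esub> a \<in> K" using s by simp
    qed (use R in \<open>auto simp: matrix_algebra_simps cmat.subspace_add\<close>)
  qed (use R in \<open>auto simp: matrix_algebra_simps intro: ring_axioms\<close>)
qed

lemma finsum_subalgebra:
  assumes "finite X" "subring B (matrix_algebra X)" "finite I" "f \<in> I \<rightarrow> B"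
  shows "finsum ((matrix_algebra X)\<lparr>carrier := B\<rparr>) f I = (\<Sum>i\<in>I. f i)"
proof -
  interpret ring "(matrix_algebra X)\<lparr>carrier := B\<rparr>"
    using assms(1,2) by (rule ring_subalgebra)
  show ?thesis using assms(3,4)
  proof (induction I rule: finite_induct)
    case empty
    then show ?case by (simp add: matrix_algebra_simps)
  next
    case (insert i I)
    then have "f \<in> I \<rightarrow> B" "f i \<in> B" by auto
    then show ?case
      using insert finsum_insert[of I i f] by (auto simp: matrix_algebra_simps)
  qed
qed

section \<open>Block matrices\<close>
definition block_ones :: "'a set \<Rightarrow> 'a set \<Rightarrow> 'a cmatrix" where
  "block_ones c d = (\<lambda>x y. if x \<in> c \<and> y \<in> d then 1 else 0)"

lemma mat_mult_dual_idempotent: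
  assumes "finite X" "c \<subseteq> X" "d \<subseteq> X"
  shows "mat_mult X (dual_idempotent c) (mat_mult X M (dual_idempotent d)) =
    (\<lambda>x y. if x \<in> c \<and> y \<in> d then M x y else 0)"
proof (intro ext)
  fix x y
  have right: "mat_mult X M (dual_idempotent d) z y = (if y \<in> d then M z y else 0)" for z
  proof -
    have "mat_mult X M (dual_idempotent d) z y = (\<Sum>w\<in>X. if w = y then if y \<in> d then M z y else 0 else 0)"
      unfolding mat_mult_def by (intro sum.cong) (auto simp: dual_idempotent_def)
    then show ?thesis using assms by auto
  qed
  have "mat_mult X (dual_idempotent c) (mat_mult X M (dual_idempotent d)) x y =
      (\<Sum>z\<in>X. if z = x then if x \<in> c \<and> y \<in> d then M x y else 0 else 0)"
    unfolding mat_mult_def[of X "dual_idempotent c"] right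
    by (intro sum.cong) (auto simp: dual_idempotent_def)
  then show "mat_mult X (dual_idempotent c) (mat_mult X M (dual_idempotent d)) x y =
      (if x \<in> c \<and> y \<in> d then M x y else 0)"
    using assms by auto
qed

text \<open>The \<open>n\<close> entries of a row are one \<open>1\<close> and \<open>n - 1\<close> copies of \<open>- 1 / (n - 1)\<close>.\<close>
lemma class_matrix_row_sum:
  assumes "card c \<ge> 2" "x \<in> c"
  shows "(\<Sum>z\<in>c. class_matrix c x z) = 0" "(\<Sum>z\<in>c. class_matrix c z x) = 0"
proof -
  define \<alpha> :: complex where "\<alpha> = - 1 / (of_nat (card c) - 1)"
  have c: "finite c" using assms(1) card.infinite by fastforce
  have "of_nat (card c) \<noteq> (1 :: complex)"
    using assms(1) of_nat_eq_1_iff[where 'a = complex] by simp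
  then have \<alpha>: "\<alpha> * of_nat (card c) + (1 - \<alpha>) = 0"
    by (simp add: \<alpha>_def field_simps)
  have "(\<Sum>z\<in>c. class_matrix c x z) = (\<Sum>z\<in>c. \<alpha> + (if z = x then 1 - \<alpha> else 0))"
    "(\<Sum>z\<in>c. class_matrix c z x) = (\<Sum>z\<in>c. \<alpha> + (if z = x then 1 - \<alpha> else 0))"
    using assms(2) by (auto simp: class_matrix_def Let_def \<alpha>_def intro!: sum.cong)
  moreover have "(\<Sum>z\<in>c. \<alpha> + (if z = x then 1 - \<alpha> else 0)) = 0"
    using c assms(2) \<alpha> by (simp add: sum.distrib mult.commute)
  ultimately show "(\<Sum>z\<in>c. class_matrix c x z) = 0" "(\<Sum>z\<in>c. class_matrix c z x) = 0"
    by simp_all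
qed

lemma class_matrix_outside: "x \<notin> c \<or> y \<notin> c \<Longrightarrow> class_matrix c x y = 0"
  by (auto simp: class_matrix_def Let_def)

text \<open>All-ones blocks are rank-one matrices, so sandwiching \<open>M\<close> between two of them leaves a multiple of an
  all-ones block; the factor is the sum of the entries of a block of \<open>M\<close>.\<close>
lemma mat_mult_block_ones:
  assumes "finite X" "d \<subseteq> X" "d' \<subseteq> X"
  shows "mat_mult X (block_ones c d) (mat_mult X M (block_ones d' c')) =
    mat_scale (\<Sum>z\<in>d. \<Sum>w\<in>d'. M z w) (block_ones c c')"
proof (intro ext)
  fix x y
  have M: "mat_mult X M (block_ones d' c') z y = (\<Sum>w\<in>d'. M z w) * (if y \<in> c' then 1 else 0)" for z
    unfolding mat_mult_def block_ones_def sum_distrib_right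
    using assms by (intro sum.mono_neutral_cong_right) auto
  have "mat_mult X (block_ones c d) (mat_mult X M (block_ones d' c')) x y =
      (\<Sum>z\<in>d. (if x \<in> c then 1 else 0) * ((\<Sum>w\<in>d'. M z w) * (if y \<in> c' then 1 else 0)))"
    unfolding mat_mult_def[of X "block_ones c d"] M unfolding block_ones_def
    using assms by (intro sum.mono_neutral_cong_right) auto
  then show "mat_mult X (block_ones c d) (mat_mult X M (block_ones d' c')) x y =
      mat_scale (\<Sum>z\<in>d. \<Sum>w\<in>d'. M z w) (block_ones c c') x y"
    by (auto simp: mat_scale_def block_ones_def)
qed

text \<open>An antichain of nonzero ideals such that every nonzero ideal lies above one of its members
  consists of the minimal ideals.\<close>
lemma bij_betw_minimal_ideals:
  assumes ideals: "\<And>i. i \<in> I \<Longrightarrow> ideal (F i) R \<and> F i \<noteq> {\<zero>\<^bsub>R\<^esub>}"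
    and incomparable: "\<And>i j. i \<in> I \<Longrightarrow> j \<in> I \<Longrightarrow> F i \<subseteq> F j \<Longrightarrow> i = j"
    and cofinal: "\<And>K. ideal K R \<Longrightarrow> K \<noteq> {\<zero>\<^bsub>R\<^esub>} \<Longrightarrow> \<exists>i\<in>I. F i \<subseteq> K"
  shows "bij_betw F I {J. minimal_ideal J R}"
proof (rule bij_betw_imageI)
  show "inj_on F I"
    using incomparable by (auto intro: inj_onI)
  show "F ` I = {J. minimal_ideal J R}"
  proof (intro equalityI subsetI)
    fix K assume "K \<in> F ` I"
    then obtain i where i: "i \<in> I" "K = F i" by blast
    have "J = F i" if J: "ideal J R" "J \<subseteq> F i" "J \<noteq> {\<zero>\<^bsub>R\<^esub>}" for J
    proof -
      obtain j where j: "j \<in> I" "F j \<subseteq> J" using cofinal J by blast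
      then have "j = i" using incomparable i J(2) by blast
      then show ?thesis using j J(2) by blast
    qed
    then show "K \<in> {J. minimal_ideal J R}"
      using i ideals unfolding minimal_ideal_def by blast
  next
    fix K assume "K \<in> {J. minimal_ideal J R}"
    then have K: "ideal K R" "K \<noteq> {\<zero>\<^bsub>R\<^esub>}"
      "\<And>J. ideal J R \<Longrightarrow> J \<subseteq> K \<Longrightarrow> J = {\<zero>\<^bsub>R\<^esub>} \<or> J = K"
      unfolding minimal_ideal_def by auto
    then obtain i where "i \<in> I" "F i \<subseteq> K" using cofinal by blast
    then show "K \<in> F ` I" using K(3) ideals by blast
  qed
qed

section \<open>The Wedderburn decomposition of the block algebra of a partition\<close>

text \<open>The model is a finite group partitioned into its conjugacy classes, based at the class of the
  identity, with trivial centre. On a singleton part the identity and the all-ones matrix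
  coincide, which is why the base part contributes no component of its own.\<close>
locale based_partition =
  fixes X :: "'a set" and I :: "'i set" and C :: "'i \<Rightarrow> 'a set" and i0 :: 'i
  assumes finite_index: "finite I"
    and base_index: "i0 \<in> I"
    and disjoint_parts: "disjoint_family_on C I"
    and union_parts: "(\<Union>i\<in>I. C i) = X"
    and card_base: "card (C i0) = 1"
    and card_part: "\<And>i. i \<in> I \<Longrightarrow> i \<noteq> i0 \<Longrightarrow> card (C i) \<ge> 2"
begin

definition idx :: "'a \<Rightarrow> 'i" where "idx x = (THE i. i \<in> I \<and> x \<in> C i)"

text \<open>The parameters are not determined by the matrix: on the base part only \<open>a i0 i0 + b i0\<close> is. For the
  other parts \<open>b i\<close> is recovered by \<open>gap\<close> below.\<close>
definition block_matrix :: "('i \<Rightarrow> 'i \<Rightarrow> complex) \<Rightarrow> ('i \<Rightarrow> complex) \<Rightarrow> 'a cmatrix" where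
  "block_matrix a b = (\<lambda>x y. if x \<in> X \<and> y \<in> X
     then a (idx x) (idx y) + (if x = y then b (idx x) else 0) else 0)"

definition block_matrices :: "'a cmatrix set" where
  "block_matrices = {block_matrix a b | a b. True}"

definition constant_blocks :: "'a cmatrix set" where
  "constant_blocks = {block_matrix a (\<lambda>_. 0) | a. True}"

abbreviation block_algebra :: "'a cmatrix ring" where
  "block_algebra \<equiv> (matrix_algebra X)\<lparr>carrier := block_matrices\<rparr>"

lemma block_matrix_mem [simp, intro]: "block_matrix a b \<in> block_matrices"
  unfolding block_matrices_def by blast

lemma block_matrix_mem_constant [simp, intro]: "block_matrix a (\<lambda>_. 0) \<in> constant_blocks"
  unfolding constant_blocks_def by blast

lemma block_matricesE:
  assumes "M \<in> block_matrices" obtains a b where "M = block_matrix a b"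
  using assms unfolding block_matrices_def by blast

lemma constant_blocksE:
  assumes "M \<in> constant_blocks" obtains a where "M = block_matrix a (\<lambda>_. 0)"
  using assms unfolding constant_blocks_def by blast

lemma finite_part: "i \<in> I \<Longrightarrow> finite (C i)"
  using card_base card_part card.infinite by (metis not_numeral_le_zero zero_neq_one)

lemma card_part_pos: "i \<in> I \<Longrightarrow> card (C i) > 0"
  using card_base card_part by (metis less_le_trans pos2 zero_less_one)

lemma finite_X: "finite X"
  using finite_index finite_part union_parts by blast

lemma idx_eq: "i \<in> I \<Longrightarrow> x \<in> C i \<Longrightarrow> idx x = i"
  unfolding idx_def using disjoint_parts
  by (intro the_equality) (auto simp: disjoint_family_on_def)

lemma idx_in: "x \<in> X \<Longrightarrow> idx x \<in> I \<and> x \<in> C (idx x)"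
  using union_parts idx_eq by auto

lemma mem_part_iff: "i \<in> I \<Longrightarrow> x \<in> C i \<longleftrightarrow> x \<in> X \<and> idx x = i"
  using idx_eq idx_in union_parts by blast

lemma base_unique: "x \<in> X \<Longrightarrow> y \<in> X \<Longrightarrow> idx x = i0 \<Longrightarrow> idx y = i0 \<Longrightarrow> x = y"
  using card_base mem_part_iff[OF base_index] by (metis card_1_singletonE singletonD)

lemma block_matrix_add: "block_matrix a b + block_matrix a' b' = block_matrix (\<lambda>i j. a i j + a' i j) (\<lambda>i. b i + b' i)"
  by (auto simp: block_matrix_def fun_eq_iff)

lemma block_matrix_scale: "mat_scale c (block_matrix a b) = block_matrix (\<lambda>i j. c * a i j) (\<lambda>i. c * b i)"
  by (auto simp: block_matrix_def mat_scale_def fun_eq_iff algebra_simps)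

lemma block_matrix_zero: "block_matrix (\<lambda>_ _. 0) (\<lambda>_. 0) = 0"
  by (auto simp: block_matrix_def fun_eq_iff)

lemma block_matrix_one: "block_matrix (\<lambda>_ _. 0) (\<lambda>_. 1) = \<one>\<^bsub>matrix_algebra X\<^esub>"
  by (auto simp: block_matrix_def matrix_algebra_simps fun_eq_iff)

text \<open>Off-diagonal and diagonal parameters multiply as in an extension of the algebra of the \<open>b\<close>'s
  by the ideal of matrices with \<open>b = 0\<close>: the second parameter is multiplicative, so
  \<open>constant_blocks\<close> is an ideal.\<close>
lemma block_matrix_mult:
  "mat_mult X (block_matrix a b) (block_matrix a' b') =
     block_matrix (\<lambda>i j. (\<Sum>z\<in>X. a i (idx z) * a' (idx z) j) + a i j * b' j + b i * a' i j)
       (\<lambda>i. b i * b' i)" (is "?l = ?r")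
proof (intro ext)
  fix x y
  show "?l x y = ?r x y"
  proof (cases "x \<in> X \<and> y \<in> X")
    case True
    have "?l x y = (\<Sum>z\<in>X. a (idx x) (idx z) * a' (idx z) (idx y)
        + (if z = y then a (idx x) (idx y) * b' (idx y) else 0)
        + (if z = x then b (idx x) * a' (idx x) (idx y) else 0)
        + (if z = x then if x = y then b (idx x) * b' (idx x) else 0 else 0))"
      unfolding mat_mult_def block_matrix_def using True
      by (intro sum.cong) (auto simp: algebra_simps)
    then show ?thesis
      using True finite_X by (simp add: sum.distrib block_matrix_def)
  next
    case False
    then show ?thesis by (auto simp: mat_mult_def block_matrix_def intro!: sum.neutral)
  qed
qed

lemma subspace_block_matrices: "cmat.subspace block_matrices"
  unfolding cmat.subspace_def
proof (intro conjI ballI allI)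
  show "0 \<in> block_matrices"
    using block_matrix_zero by (metis block_matrix_mem)
qed (auto elim!: block_matricesE simp: block_matrix_add block_matrix_scale)

lemma subspace_constant_blocks: "cmat.subspace constant_blocks"
  unfolding cmat.subspace_def
proof (intro conjI ballI allI)
  show "0 \<in> constant_blocks"
    using block_matrix_zero by (metis block_matrix_mem_constant)
qed (auto elim!: constant_blocksE simp: block_matrix_add block_matrix_scale)

lemma subring_block_matrices: "subring block_matrices (matrix_algebra X)"
proof (rule subring_matrix_algebraI[OF finite_X subspace_block_matrices])
  show "block_matrices \<subseteq> carrier (matrix_algebra X)"
    by (auto simp: block_matrix_def matrix_algebra_simps split: if_splits elim!: block_matricesE)
  show "\<one>\<^bsub>matrix_algebra X\<^esub> \<in> block_matrices"
    unfolding block_matrix_one[symmetric] by blast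
qed (auto elim!: block_matricesE simp: block_matrix_mult)

lemmas ideal_iff = ideal_subalgebra_iff[OF finite_X subring_block_matrices subspace_block_matrices]

lemma ideal_constant_blocks: "ideal constant_blocks block_algebra"
  unfolding ideal_iff using subspace_constant_blocks
  by (auto elim!: constant_blocksE block_matricesE simp: block_matrix_mult)

lemma block_ones_apply:
  assumes "i \<in> I" "j \<in> I"
  shows "block_ones (C i) (C j) x y = (if x \<in> X \<and> y \<in> X \<and> idx x = i \<and> idx y = j then 1 else 0)"
  using assms by (auto simp: block_ones_def mem_part_iff)

lemma dual_idempotent_apply:
  assumes "i \<in> I"
  shows "dual_idempotent (C i) x y = (if x \<in> X \<and> x = y \<and> idx x = i then 1 else 0)"
  using assms by (auto simp: dual_idempotent_def mem_part_iff)

lemma block_ones_eq: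
  assumes "i \<in> I" "j \<in> I"
  shows "block_ones (C i) (C j) = block_matrix (\<lambda>k l. if k = i \<and> l = j then 1 else 0) (\<lambda>_. 0)"
  using assms by (auto simp: block_ones_apply block_matrix_def fun_eq_iff)

lemma dual_idempotent_eq:
  assumes "i \<in> I"
  shows "dual_idempotent (C i) = block_matrix (\<lambda>_ _. 0) (\<lambda>k. if k = i then 1 else 0)"
  using assms by (auto simp: dual_idempotent_apply block_matrix_def fun_eq_iff)

lemma block_matrix_sum:
  "block_matrix a b =
     (\<Sum>(i, j)\<in>I \<times> I. mat_scale (a i j) (block_ones (C i) (C j)))
     + (\<Sum>i\<in>I. mat_scale (b i) (dual_idempotent (C i)))" (is "?l = ?r")
proof (intro ext)
  fix x y
  have 1: "(\<Sum>(i, j)\<in>I \<times> I. mat_scale (a i j) (block_ones (C i) (C j))) x y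
      = (if x \<in> X \<and> y \<in> X then a (idx x) (idx y) else 0)"
  proof -
    have "(\<Sum>(i, j)\<in>I \<times> I. mat_scale (a i j) (block_ones (C i) (C j))) x y
      = (\<Sum>ij\<in>I \<times> I. if ij = (idx x, idx y) then if x \<in> X \<and> y \<in> X then a (idx x) (idx y) else 0 else 0)"
      unfolding sum_cmatrix_apply
      by (intro sum.cong) (auto simp: mat_scale_def block_ones_apply split: if_splits)
    then show ?thesis using finite_index idx_in by auto
  qed
  have 2: "(\<Sum>i\<in>I. mat_scale (b i) (dual_idempotent (C i))) x y
      = (if x \<in> X \<and> x = y then b (idx x) else 0)"
  proof -
    have "(\<Sum>i\<in>I. mat_scale (b i) (dual_idempotent (C i))) x y
      = (\<Sum>i\<in>I. if i = idx x then if x \<in> X \<and> x = y then b (idx x) else 0 else 0)"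
      unfolding sum_cmatrix_apply
      by (intro sum.cong) (auto simp: mat_scale_def dual_idempotent_apply)
    then show ?thesis using finite_index idx_in by auto
  qed
  show "?l x y = ?r x y"
    by (auto simp: 1 2 block_matrix_def)
qed

lemma block_matrix_mem_subspace:
  assumes "cmat.subspace K"
    and "\<And>i j. i \<in> I \<Longrightarrow> j \<in> I \<Longrightarrow> a i j \<noteq> 0 \<Longrightarrow> block_ones (C i) (C j) \<in> K"
    and "\<And>i. i \<in> I \<Longrightarrow> b i \<noteq> 0 \<Longrightarrow> dual_idempotent (C i) \<in> K"
  shows "block_matrix a b \<in> K"
proof -
  have "mat_scale (a i j) (block_ones (C i) (C j)) \<in> K" if "i \<in> I" "j \<in> I" for i j
    using assms(2)[OF that] cmat.subspace_scale[OF assms(1)] cmat.subspace_0[OF assms(1)]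
    by (cases "a i j = 0") simp_all
  moreover have "mat_scale (b i) (dual_idempotent (C i)) \<in> K" if "i \<in> I" for i
    using assms(3)[OF that] cmat.subspace_scale[OF assms(1)] cmat.subspace_0[OF assms(1)]
    by (cases "b i = 0") simp_all
  ultimately show ?thesis
    unfolding block_matrix_sum
    by (intro cmat.subspace_add cmat.subspace_sum assms(1)) auto
qed

lemma constant_blocks_eq_span:
  "constant_blocks = cmat.span ((\<lambda>(i, j). block_ones (C i) (C j)) ` (I \<times> I))" (is "_ = cmat.span ?S")
proof (intro equalityI)
  show "constant_blocks \<subseteq> cmat.span ?S"
  proof
    fix M assume "M \<in> constant_blocks"
    then obtain a where M: "M = block_matrix a (\<lambda>_. 0)" by (rule constant_blocksE)
    have "block_ones (C i) (C j) \<in> cmat.span ?S" if "i \<in> I" "j \<in> I" for i j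
      using that by (intro cmat.span_base) auto
    then show "M \<in> cmat.span ?S"
      unfolding M by (intro block_matrix_mem_subspace cmat.subspace_span) auto
  qed
  show "cmat.span ?S \<subseteq> constant_blocks"
    by (rule cmat.span_minimal[OF _ subspace_constant_blocks])
      (auto simp: block_ones_eq)
qed

text \<open>The all-ones blocks have disjoint nonempty supports, so evaluation at one chosen point in each
  support separates them.\<close>
lemma dim_constant_blocks: "cmat.dim constant_blocks = (card I)\<^sup>2"
proof -
  let ?J = "\<lambda>(i, j). block_ones (C i) (C j)"
  have "\<exists>x. x \<in> C i" if "i \<in> I" for i
    using card_part_pos[OF that] by (metis card_gt_0_iff ex_in_conv)
  then obtain p where p: "\<And>i. i \<in> I \<Longrightarrow> p i \<in> C i" by metis
  have J: "block_ones (C i) (C j) (p k) (p l) = (if i = k \<and> j = l then 1 else 0)"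
    if "i \<in> I" "j \<in> I" "k \<in> I" "l \<in> I" for i j k l
    using p[OF that(3)] p[OF that(4)] that by (auto simp: block_ones_apply mem_part_iff)
  have inj: "inj_on ?J (I \<times> I)"
  proof (rule inj_onI, clarify)
    fix i j k l assume *: "i \<in> I" "j \<in> I" "k \<in> I" "l \<in> I" "block_ones (C i) (C j) = block_ones (C k) (C l)"
    then show "i = k \<and> j = l"
      using J[of i j k l] J[of k l k l] by (auto split: if_splits)
  qed
  have "cmat.independent (?J ` (I \<times> I))"
  proof (rule cmat.independent_if_scalars_zero)
    show "finite (?J ` (I \<times> I))" using finite_index by simp
    fix f M assume f: "(\<Sum>M\<in>?J ` (I \<times> I). mat_scale (f M) M) = 0" and "M \<in> ?J ` (I \<times> I)"
    then obtain k l where kl: "k \<in> I" "l \<in> I" "M = ?J (k, l)" by blast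
    have "0 = (\<Sum>M\<in>?J ` (I \<times> I). mat_scale (f M) M) (p k) (p l)"
      using f by simp
    also have "\<dots> = (\<Sum>ij\<in>I \<times> I. f (?J ij) * ?J ij (p k) (p l))"
      by (simp add: sum.reindex[OF inj] sum_cmatrix_apply mat_scale_def)
    also have "\<dots> = (\<Sum>ij\<in>I \<times> I. if ij = (k, l) then f M else 0)"
      using kl by (intro sum.cong) (auto simp: J split: if_splits)
    also have "\<dots> = f M" using kl finite_index by simp
    finally show "f M = 0" by simp
  qed
  then show ?thesis
    unfolding constant_blocks_eq_span
    by (simp add: cmat.dim_eq_card_independent card_image[OF inj] card_cartesian_product power2_eq_square)
qed

lemma class_matrix_eq:
  fixes i defines "\<alpha> \<equiv> - 1 / (of_nat (card (C i)) - 1)"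
  assumes "i \<in> I"
  shows "class_matrix (C i) =
    block_matrix (\<lambda>k l. if k = i \<and> l = i then \<alpha> else 0) (\<lambda>k. if k = i then 1 - \<alpha> else 0)"
  using assms(2) by (auto simp: class_matrix_def Let_def \<alpha>_def block_matrix_def fun_eq_iff mem_part_iff)

lemma class_matrix_mem: "i \<in> I \<Longrightarrow> class_matrix (C i) \<in> block_matrices"
  by (simp add: class_matrix_eq)

text \<open>By the vanishing row and column sums only the parameter \<open>b\<close> survives, so \<open>class_matrix (C i)\<close> is
  central and spans a one-dimensional ideal.\<close>
lemma class_matrix_mult:
  assumes i: "i \<in> I" "i \<noteq> i0"
  shows "mat_mult X (class_matrix (C i)) (block_matrix a b) = mat_scale (b i) (class_matrix (C i))"
    and "mat_mult X (block_matrix a b) (class_matrix (C i)) = mat_scale (b i) (class_matrix (C i))"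
proof -
  let ?B = "class_matrix (C i)"
  have sub: "C i \<subseteq> X" using i(1) union_parts by blast
  have fin: "finite (C i)" using i(1) by (rule finite_part)
  show "mat_mult X ?B (block_matrix a b) = mat_scale (b i) ?B"
  proof (intro ext)
    fix x y
    show "mat_mult X ?B (block_matrix a b) x y = mat_scale (b i) ?B x y"
    proof (cases "x \<in> C i \<and> y \<in> X")
      case True
      have "mat_mult X ?B (block_matrix a b) x y = (\<Sum>z\<in>C i. ?B x z * block_matrix a b z y)"
        unfolding mat_mult_def using sub finite_X
        by (intro sum.mono_neutral_right) (auto simp: class_matrix_outside)
      also have "\<dots> = (\<Sum>z\<in>C i. ?B x z * a i (idx y) + (if z = y then ?B x y * b i else 0))"
        using True i by (intro sum.cong) (auto simp: block_matrix_def mem_part_iff algebra_simps)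
      also have "\<dots> = (\<Sum>z\<in>C i. ?B x z) * a i (idx y) + (if y \<in> C i then ?B x y * b i else 0)"
        using fin by (simp add: sum.distrib sum_distrib_right)
      also have "\<dots> = mat_scale (b i) ?B x y"
        using True card_part[OF i] by (auto simp: class_matrix_row_sum mat_scale_def class_matrix_outside)
      finally show ?thesis .
    next
      case False
      then have "class_matrix (C i) x y = 0"
        using sub by (intro class_matrix_outside) auto
      with False show ?thesis
        using sub by (auto simp: mat_mult_def mat_scale_def block_matrix_def class_matrix_outside intro!: sum.neutral)
    qed
  qed
  show "mat_mult X (block_matrix a b) ?B = mat_scale (b i) ?B"
  proof (intro ext)
    fix x y
    show "mat_mult X (block_matrix a b) ?B x y = mat_scale (b i) ?B x y"
    proof (cases "y \<in> C i \<and> x \<in> X")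
      case True
      have "mat_mult X (block_matrix a b) ?B x y = (\<Sum>z\<in>C i. block_matrix a b x z * ?B z y)"
        unfolding mat_mult_def using sub finite_X
        by (intro sum.mono_neutral_right) (auto simp: class_matrix_outside)
      also have "\<dots> = (\<Sum>z\<in>C i. a (idx x) i * ?B z y + (if z = x then b i * ?B x y else 0))"
        using True i by (intro sum.cong) (auto simp: block_matrix_def mem_part_iff algebra_simps)
      also have "\<dots> = a (idx x) i * (\<Sum>z\<in>C i. ?B z y) + (if x \<in> C i then b i * ?B x y else 0)"
        using fin by (simp add: sum.distrib sum_distrib_left)
      also have "\<dots> = mat_scale (b i) ?B x y"
        using True card_part[OF i] by (auto simp: class_matrix_row_sum mat_scale_def class_matrix_outside)
      finally show ?thesis .
    next
      case False
      then have "class_matrix (C i) x y = 0"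
        using sub by (intro class_matrix_outside) auto
      with False show ?thesis
        using sub by (auto simp: mat_mult_def mat_scale_def block_matrix_def class_matrix_outside intro!: sum.neutral)
    qed
  qed
qed

lemma class_matrix_line: "cmat.span {class_matrix c} = range (\<lambda>k. mat_scale k (class_matrix c))"
  by (rule cmat.span_singleton)

lemma ideal_class_matrix:
  assumes i: "i \<in> I" "i \<noteq> i0"
  shows "ideal (cmat.span {class_matrix (C i)}) block_algebra"
  unfolding ideal_iff
proof (intro conjI ballI)
  show "cmat.span {class_matrix (C i)} \<subseteq> block_matrices"
    using class_matrix_mem[OF i(1)] subspace_block_matrices by (intro cmat.span_minimal) auto
next
  fix M N assume "M \<in> cmat.span {class_matrix (C i)}" and "N \<in> block_matrices"
  then obtain k a b where MN: "M = mat_scale k (class_matrix (C i))" "N = block_matrix a b"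
    by (auto simp: class_matrix_line elim!: block_matricesE)
  show "mat_mult X N M \<in> cmat.span {class_matrix (C i)}" "mat_mult X M N \<in> cmat.span {class_matrix (C i)}"
    unfolding MN mat_mult_scale class_matrix_mult[OF i]
    by (intro cmat.span_scale cmat.span_base; simp)+
qed (rule cmat.subspace_span)

text \<open>A linear functional that extracts the parameter \<open>b i\<close>, that is, the eigenvalue of a block matrix on
  the vectors supported on \<open>C i\<close> with coordinate sum zero. On block matrices its value does
  not depend on which two distinct points of \<open>C i\<close> are chosen.\<close>
definition gap :: "'i \<Rightarrow> 'a cmatrix \<Rightarrow> complex" where
  "gap i M = (case SOME (x, y). x \<in> C i \<and> y \<in> C i \<and> x \<noteq> y of (x, y) \<Rightarrow> M x x - M x y)"

lemma gap_block_matrix: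
  assumes i: "i \<in> I" "i \<noteq> i0"
  shows "gap i (block_matrix a b) = b i"
proof -
  let ?P = "\<lambda>(x, y). x \<in> C i \<and> y \<in> C i \<and> x \<noteq> y"
  obtain x y where "x \<in> C i" "y \<in> C i" "x \<noteq> y"
    using card_part[OF i] card_le_Suc0_iff_eq[OF finite_part[OF i(1)]] by fastforce
  then have "?P (SOME u. ?P u)"
    using someI[of ?P "(x, y)"] by simp
  then show ?thesis
    using i unfolding gap_def
    by (auto simp: block_matrix_def mem_part_iff split: prod.splits)
qed

lemma gap_sum: "gap i (\<Sum>j\<in>S. M j) = (\<Sum>j\<in>S. gap i (M j))"
  by (simp add: gap_def sum_cmatrix_apply sum_subtractf split: prod.split)

lemma gap_diff: "gap i (M - N) = gap i M - gap i N"
  and gap_scale: "gap i (mat_scale k M) = k * gap i M"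
  by (simp_all add: gap_def mat_scale_def algebra_simps split: prod.split)

lemma gap_constant_blocks:
  "i \<in> I \<Longrightarrow> i \<noteq> i0 \<Longrightarrow> M \<in> constant_blocks \<Longrightarrow> gap i M = 0"
  by (auto elim!: constant_blocksE simp: gap_block_matrix)

lemma gap_class_matrix:
  assumes "i \<in> I" "i \<noteq> i0" "j \<in> I"
  shows "gap i (class_matrix (C j)) \<noteq> 0 \<longleftrightarrow> i = j"
proof -
  have "1 + 1 / (of_nat (card (C i)) - 1) \<noteq> (0 :: complex)"
  proof
    assume *: "1 + 1 / (of_nat (card (C i)) - 1) = (0 :: complex)"
    have "of_nat (card (C i)) \<noteq> (1 :: complex)"
      using card_part[OF assms(1,2)] of_nat_eq_1_iff[where 'a = complex] by simp
    with * show False using card_part[OF assms(1,2)] by (simp add: field_simps)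
  qed
  then show ?thesis
    using assms by (auto simp: class_matrix_eq gap_block_matrix)
qed

lemma constant_blocks_iff_gap:
  assumes "M \<in> block_matrices"
  shows "M \<in> constant_blocks \<longleftrightarrow> (\<forall>i\<in>I - {i0}. gap i M = 0)"
proof
  assume *: "\<forall>i\<in>I - {i0}. gap i M = 0"
  obtain a b where M: "M = block_matrix a b" using assms by (rule block_matricesE)
  have b: "b i = 0" if "i \<in> I" "i \<noteq> i0" for i
    using * that gap_block_matrix[OF that, of a b] M by auto
  \<comment> \<open>The remaining diagonal parameter \<open>b i0\<close> sits on a single entry and can be moved into \<open>a i0 i0\<close>.\<close>
  have "M = block_matrix (\<lambda>k l. a k l + (if k = i0 \<and> l = i0 then b i0 else 0)) (\<lambda>_. 0)"
  proof (intro ext)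
    fix x y
    show "M x y = block_matrix (\<lambda>k l. a k l + (if k = i0 \<and> l = i0 then b i0 else 0)) (\<lambda>_. 0) x y"
    proof (cases "x \<in> X \<and> y \<in> X")
      case True
      then have "idx x = i0 \<and> idx y = i0 \<Longrightarrow> x = y" "idx x \<noteq> i0 \<Longrightarrow> b (idx x) = 0"
        using base_unique b idx_in by blast+
      with True show ?thesis
          unfolding M block_matrix_def by (cases "idx x = i0"; cases "idx y = i0") auto
    qed (auto simp: M block_matrix_def)
  qed
  then show "M \<in> constant_blocks" by (rule ssubst) (rule block_matrix_mem_constant)
qed (auto simp: gap_constant_blocks)

definition component :: "'i \<Rightarrow> 'a cmatrix set" where
  "component i = (if i = i0 then constant_blocks else cmat.span {class_matrix (C i)})"

lemma component_ideal: "i \<in> I \<Longrightarrow> ideal (component i) block_algebra"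
  by (simp add: component_def ideal_constant_blocks ideal_class_matrix)

lemma component_nonzero:
  assumes "i \<in> I" shows "component i \<noteq> {0}"
proof (cases "i = i0")
  case True
  have "cmat.dim constant_blocks \<noteq> 0"
    using dim_constant_blocks finite_index base_index by auto
  moreover have "cmat.dim {0 :: 'a cmatrix} = 0"
    using cmat.dim_span[of "{} :: 'a cmatrix set"] cmat.dim_eq_card_independent[OF cmat.independent_empty]
    by (simp only: cmat.span_empty card.empty)
  ultimately show ?thesis using True by (auto simp: component_def)
next
  case False
  have "class_matrix (C i) \<noteq> 0"
    using gap_class_matrix[of i i] False assms by (auto simp: gap_def split: prod.splits)
  then show ?thesis
    using cmat.span_base[of "class_matrix (C i)" "{class_matrix (C i)}"] False
    by (auto simp: component_def)
qed

text \<open>The base entry separates \<open>constant_blocks\<close> from the other components, and \<open>gap i\<close> vanishes on every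
  component but the \<open>i\<close>-th.\<close>
lemma component_incomparable:
  assumes i: "i \<in> I" and j: "j \<in> I" and sub: "component i \<subseteq> component j"
  shows "i = j"
proof (rule ccontr)
  assume "i \<noteq> j"
  show False
  proof (cases "i = i0")
    case True
    obtain o' where "C i0 = {o'}" using card_base card_1_singletonE by blast
    then have "o' \<notin> C j" "block_ones (C i0) (C i0) o' o' = 1"
      using \<open>i \<noteq> j\<close> True i j disjoint_parts by (auto simp: disjoint_family_on_def block_ones_def)
    moreover have "block_ones (C i0) (C i0) \<in> component i"
      using True by (simp add: component_def block_ones_eq base_index)
    ultimately show False
      using sub \<open>i \<noteq> j\<close> True by (auto simp: component_def class_matrix_line mat_scale_def class_matrix_outside)
  next
    case False
    have "class_matrix (C i) \<in> component j"
      using sub False by (auto simp: component_def intro: cmat.span_base)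
    then have "gap i (class_matrix (C i)) = 0"
      using gap_class_matrix[OF i False j] gap_constant_blocks[OF i False] \<open>i \<noteq> j\<close>
      by (auto simp: component_def class_matrix_line gap_scale split: if_splits)
    then show False using gap_class_matrix[OF i False i] by simp
  qed
qed

text \<open>Let \<open>M\<close> be a nonzero element of the ideal. If some \<open>gap i M\<close> is nonzero, multiplying by
  \<open>class_matrix (C i)\<close> isolates that line. Otherwise \<open>M\<close> is constant on blocks, and sandwiching it between
  all-ones blocks that meet one of its nonzero blocks produces all of them.\<close>
lemma nonzero_ideal_contains_component:
  assumes K: "ideal K block_algebra" and nz: "K \<noteq> {0}"
  shows "\<exists>i\<in>I. component i \<subseteq> K"
proof -
  have sub: "cmat.subspace K" "K \<subseteq> block_matrices"
    and mult: "\<And>a x. a \<in> K \<Longrightarrow> x \<in> block_matrices \<Longrightarrow> mat_mult X x a \<in> K \<and> mat_mult X a x \<in> K"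
    using K unfolding ideal_iff by auto
  obtain M where M: "M \<in> K" "M \<noteq> 0"
    using nz cmat.subspace_0[OF sub(1)] by blast
  show ?thesis
  proof (cases "\<exists>i\<in>I - {i0}. gap i M \<noteq> 0")
    case True
    then obtain i where i: "i \<in> I" "i \<noteq> i0" "gap i M \<noteq> 0" by blast
    obtain a b where ab: "M = block_matrix a b"
      using M sub by (blast elim: block_matricesE)
    have "mat_scale (b i) (class_matrix (C i)) \<in> K"
      using mult[OF M(1) class_matrix_mem[OF i(1)]] class_matrix_mult(1)[OF i(1,2)] ab by simp
    then have "mat_scale (1 / b i) (mat_scale (b i) (class_matrix (C i))) \<in> K"
      by (rule cmat.subspace_scale[OF sub(1)])
    then have "class_matrix (C i) \<in> K"
      using i ab by (simp add: gap_block_matrix)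
    then have "component i \<subseteq> K"
      using i sub(1) cmat.span_minimal[of "{class_matrix (C i)}" K] by (simp add: component_def)
    then show ?thesis using i by blast
  next
    case False
    then have "M \<in> constant_blocks"
      using constant_blocks_iff_gap M sub by blast
    then obtain a where a: "M = block_matrix a (\<lambda>_. 0)" by (rule constant_blocksE)
    with M(2) obtain x y where "block_matrix a (\<lambda>_. 0) x y \<noteq> 0"
      by (auto simp: fun_eq_iff)
    then obtain k l where kl: "k \<in> I" "l \<in> I" "a k l \<noteq> 0"
      using idx_in by (auto simp: block_matrix_def split: if_splits)
    have "block_ones (C i) (C j) \<in> K" if ij: "i \<in> I" "j \<in> I" for i j
    proof -
      let ?s = "\<Sum>z\<in>C k. \<Sum>w\<in>C l. M z w"
      have "?s = (\<Sum>z\<in>C k. \<Sum>w\<in>C l. a k l)"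
        using kl by (intro sum.cong refl) (auto simp: a block_matrix_def mem_part_iff)
      then have s: "?s \<noteq> 0"
        using kl card_part_pos by simp
      have "mat_mult X (block_ones (C i) (C k)) (mat_mult X M (block_ones (C l) (C j))) \<in> K"
        using mult M(1) ij kl by (simp add: block_ones_eq)
      then have "mat_scale ?s (block_ones (C i) (C j)) \<in> K"
        using kl union_parts by (subst (asm) mat_mult_block_ones[OF finite_X]) auto
      then have "mat_scale (1 / ?s) (mat_scale ?s (block_ones (C i) (C j))) \<in> K"
        by (rule cmat.subspace_scale[OF sub(1)])
      then show ?thesis using s by simp
    qed
    then have "component i0 \<subseteq> K"
      unfolding component_def constant_blocks_eq_span
      using sub(1) by (simp, intro cmat.span_minimal) auto
    then show ?thesis using base_index by blast
  qed
qed

lemma component_subset: "i \<in> I \<Longrightarrow> component i \<subseteq> block_matrices"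
  using component_ideal unfolding ideal_iff by blast

text \<open>The functionals \<open>gap i\<close> determine the summands on the lines; the summand in \<open>constant_blocks\<close> is
  what remains.\<close>
lemma component_sum_unique:
  assumes M: "M \<in> block_matrices"
  shows "\<exists>!f. f \<in> (\<Pi>\<^sub>E i\<in>I. component i) \<and> (\<Sum>i\<in>I. f i) = M"
proof -
  let ?B = "\<lambda>i. class_matrix (C i)"
  define t where "t i = mat_scale (gap i M / gap i (?B i)) (?B i)" for i
  define f where "f = (\<lambda>i\<in>I. if i = i0 then M - (\<Sum>j\<in>I - {i0}. t j) else t i)"
  have t_mem: "t j \<in> component j" if "j \<in> I" "j \<noteq> i0" for j
    using that by (auto simp: t_def component_def class_matrix_line)
  have t_gap: "gap i (t j) = (if j = i then gap i M else 0)" if "i \<in> I" "i \<noteq> i0" "j \<in> I" "j \<noteq> i0" for i j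
    using that gap_class_matrix[OF that(1-3)] by (auto simp: t_def gap_scale)
  have rest: "M - (\<Sum>j\<in>I - {i0}. t j) \<in> constant_blocks"
  proof -
    have "M - (\<Sum>j\<in>I - {i0}. t j) \<in> block_matrices"
      using M t_mem component_subset
      by (intro cmat.subspace_diff cmat.subspace_sum subspace_block_matrices) blast+
    moreover have "gap i (M - (\<Sum>j\<in>I - {i0}. t j)) = 0" if "i \<in> I - {i0}" for i
    proof -
      have "(\<Sum>j\<in>I - {i0}. gap i (t j)) = (\<Sum>j\<in>I - {i0}. if j = i then gap i M else 0)"
        using that by (intro sum.cong) (auto simp: t_gap)
      then show ?thesis using that finite_index by (simp add: gap_diff gap_sum)
    qed
    ultimately show ?thesis using constant_blocks_iff_gap by blast
  qed
  show ?thesis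
  proof (rule ex1I[of _ f])
    have "(\<Sum>i\<in>I. f i) = f i0 + (\<Sum>i\<in>I - {i0}. f i)"
      using finite_index base_index by (rule sum.remove)
    also have "\<dots> = M"
      using base_index by (simp add: f_def)
    finally show "f \<in> (\<Pi>\<^sub>E i\<in>I. component i) \<and> (\<Sum>i\<in>I. f i) = M"
      using rest t_mem by (auto simp: f_def component_def)
  next
    fix g assume "g \<in> (\<Pi>\<^sub>E i\<in>I. component i) \<and> (\<Sum>i\<in>I. g i) = M"
    then have g: "g \<in> (\<Pi>\<^sub>E i\<in>I. component i)" and g_sum: "(\<Sum>i\<in>I. g i) = M" by auto
    have "g i0 \<in> constant_blocks" using PiE_mem[OF g base_index] by (simp add: component_def)
    have g_line: "\<exists>k. g j = mat_scale k (?B j)" if "j \<in> I" "j \<noteq> i0" for j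
      using g that by (auto simp: component_def class_matrix_line dest!: PiE_mem[of g I _ j])
    have g_eq: "g i = t i" if i: "i \<in> I" "i \<noteq> i0" for i
    proof -
      have "gap i (g j) = (if j = i then gap i (g i) else 0)" if "j \<in> I" for j
        using that i gap_constant_blocks[OF i \<open>g i0 \<in> constant_blocks\<close>] gap_class_matrix[OF i that] g_line[OF that]
        by (cases "j = i0") (auto simp: gap_scale)
      then have "(\<Sum>j\<in>I. gap i (g j)) = (\<Sum>j\<in>I. if j = i then gap i (g i) else 0)"
        by (intro sum.cong) auto
      then have "gap i M = gap i (g i)"
        using i finite_index by (simp add: g_sum[symmetric] gap_sum)
      then show ?thesis
        using g_line[OF i] gap_class_matrix[OF i i(1)] by (auto simp: t_def gap_scale)
    qed
    have "M = g i0 + (\<Sum>i\<in>I - {i0}. g i)"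
      unfolding g_sum[symmetric] using finite_index base_index by (rule sum.remove)
    then have "g i0 = M - (\<Sum>i\<in>I - {i0}. t i)"
      using g_eq by (simp add: algebra_simps)
    then show "g = f"
      using g g_eq by (intro PiE_ext[of g I component f]) (use rest t_mem in \<open>auto simp: f_def component_def\<close>)
  qed
qed

theorem wedderburn_block_algebra: "wedderburn_decomposition block_algebra I component"
  unfolding wedderburn_decomposition_def
proof (intro conjI ballI)
  have zero: "\<zero>\<^bsub>block_algebra\<^esub> = 0" by (simp add: matrix_algebra_simps)
  show "bij_betw component I {J. minimal_ideal J block_algebra}"
  proof (rule bij_betw_minimal_ideals[where R = block_algebra, unfolded zero])
    show "ideal (component i) block_algebra \<and> component i \<noteq> {0}" if "i \<in> I" for i
      using component_ideal[OF that] component_nonzero[OF that] by (rule conjI)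
  qed (fact component_incomparable nonzero_ideal_contains_component)+
next
  fix M assume "M \<in> carrier block_algebra"
  then have M: "M \<in> block_matrices" by simp
  have "finsum block_algebra f I = (\<Sum>i\<in>I. f i)" if "f \<in> (\<Pi>\<^sub>E i\<in>I. component i)" for f
    using that component_subset
    by (intro finsum_subalgebra[OF finite_X subring_block_matrices finite_index]) (auto simp: PiE_iff)
  then show "\<exists>!f. f \<in> (\<Pi>\<^sub>E i\<in>I. component i) \<and> finsum block_algebra f I = M"
    using component_sum_unique[OF M] by (simp cong: conj_cong)
qed (rule finite_index)

end

section \<open>Conjugacy classes\<close>
context group begin

lemma conjugation_action:
  "group_action G (carrier G) (\<lambda>g. \<lambda>h \<in> carrier G. g \<otimes> h \<otimes> inv g)"
  by (rule action_by_conjugation)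

lemma Union_conjugacy_classes: "\<Union>(conjugacy_classes G) = carrier G"
  unfolding conjugacy_classes_def
  by (rule group_action.orbits_coverture[OF conjugation_action])

lemma conjugacy_classes_disjoint:
  "c \<in> conjugacy_classes G \<Longrightarrow> d \<in> conjugacy_classes G \<Longrightarrow> c = d \<or> c \<inter> d = {}"
  unfolding conjugacy_classes_def
  by (rule group_action.disjoint_union[OF conjugation_action])

lemma conjugacy_class_eq:
  assumes "c \<in> conjugacy_classes G" "x \<in> c"
  shows "c = {g \<otimes> x \<otimes> inv g | g. g \<in> carrier G}"
proof -
  let ?o = "orbit G (\<lambda>g. \<lambda>h \<in> carrier G. g \<otimes> h \<otimes> inv g) x"
  have x: "x \<in> carrier G" using assms Union_conjugacy_classes by blast
  then have "?o \<in> conjugacy_classes G" "x \<in> ?o"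
    using group_action.orbit_refl[OF conjugation_action x]
    unfolding conjugacy_classes_def orbits_def by auto
  then have "c = ?o"
    using conjugacy_classes_disjoint[OF assms(1)] assms(2) by blast
  then show ?thesis using x by (auto simp: orbit_def)
qed

lemma inv_cancel_left:
  assumes "a \<in> carrier G" "b \<in> carrier G"
  shows "inv a \<otimes> (a \<otimes> b) = b" "a \<otimes> (inv a \<otimes> b) = b"
  using assms by (simp_all flip: m_assoc)

lemma conjugacy_class_of_one:
  "c \<in> conjugacy_classes G \<Longrightarrow> \<one> \<in> c \<Longrightarrow> c = {\<one>}"
  using conjugacy_class_eq[of c \<one>] by auto

lemma conjugate_mem_class:
  assumes "c \<in> conjugacy_classes G" "x \<in> c" "g \<in> carrier G"
  shows "g \<otimes> x \<otimes> inv g \<in> c"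
  using conjugacy_class_eq[OF assms(1,2)] assms(3) by blast

lemma conjugate_of_conjugates:
  assumes "m \<in> carrier G" "n \<in> carrier G" "h \<in> carrier G"
  shows "n \<otimes> h \<otimes> inv n = (n \<otimes> inv m) \<otimes> (m \<otimes> h \<otimes> inv m) \<otimes> inv (n \<otimes> inv m)"
  using assms by (simp add: m_assoc inv_mult_group inv_cancel_left)

end

section \<open>Terwilliger algebras whose quotients are determined by classes\<close>

text \<open>For two distinct elements \<open>x\<close> and \<open>y\<close>, the class of \<open>y \<otimes> inv x\<close> depends only on the classes
  of \<open>x\<close> and \<open>y\<close>. For equal elements this quotient is \<open>\<one>\<close>, which has to be excluded: it differs from
  the quotients of distinct elements of a single class.\<close>
locale class_partition = group G + based_partition "carrier G" I C i0
  for G (structure) and I :: "'i set" and C and i0 +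
  assumes classes: "C ` I = conjugacy_classes G"
    and base_class: "C i0 = {\<one>}"
    and quotient_class: "\<And>i j k x y x' y'. \<lbrakk>i \<in> I; j \<in> I; k \<in> I; x \<in> C i; x' \<in> C i; y \<in> C j; y' \<in> C j;
        x \<noteq> y; x' \<noteq> y'; y \<otimes> inv x \<in> C k\<rbrakk> \<Longrightarrow> y' \<otimes> inv x' \<in> C k"
begin

lemma part_closed: "i \<in> I \<Longrightarrow> x \<in> C i \<Longrightarrow> x \<in> carrier G"
  using union_parts by blast

lemma quotient_one_iff: "x \<in> carrier G \<Longrightarrow> y \<in> carrier G \<Longrightarrow> y \<otimes> inv x = \<one> \<longleftrightarrow> x = y"
  by (metis inv_closed inv_equality inv_inv r_inv)

lemma adj_matrix_block_matrix:
  assumes k: "k \<in> I"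
  shows "adj_matrix G (C k) \<in> block_matrices"
proof -
  define a :: "'i \<Rightarrow> 'i \<Rightarrow> complex" where
    "a i j = (if \<exists>x\<in>C i. \<exists>y\<in>C j. x \<noteq> y \<and> y \<otimes> inv x \<in> C k then 1 else 0)" for i j
  \<comment> \<open>A diagonal entry is \<open>a i i + b i\<close> and has to say whether \<open>\<one> \<in> C k\<close>.\<close>
  define b where "b i = (if k = i0 then 1 else 0) - a i i" for i
  have "adj_matrix G (C k) x y = block_matrix a b x y" for x y
  proof (cases "x \<in> carrier G \<and> y \<in> carrier G")
    case True
    then have xy: "idx x \<in> I" "x \<in> C (idx x)" "idx y \<in> I" "y \<in> C (idx y)"
      using idx_in by auto
    show ?thesis
    proof (cases "x = y")
      case True
      have "\<one> \<in> C k \<longleftrightarrow> k = i0"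
        using mem_part_iff[OF k, of \<one>] mem_part_iff[OF base_index, of \<one>] base_class by auto
      then show ?thesis
        using True xy \<open>x \<in> carrier G \<and> y \<in> carrier G\<close>
        by (simp add: adj_matrix_def block_matrix_def b_def r_inv)
    next
      case False
      then have "y \<otimes> inv x \<in> C k \<longleftrightarrow> (\<exists>x'\<in>C (idx x). \<exists>y'\<in>C (idx y). x' \<noteq> y' \<and> y' \<otimes> inv x' \<in> C k)"
        using xy k quotient_class by blast
      then show ?thesis
        using True False by (simp add: adj_matrix_def block_matrix_def a_def)
    qed
  qed (auto simp: adj_matrix_def block_matrix_def)
  then have "adj_matrix G (C k) = block_matrix a b" by (intro ext)
  then show ?thesis by simp
qed

text \<open>Choose \<open>k\<close> as the class of \<open>y \<otimes> inv x\<close> for some \<open>x \<noteq> y\<close> in \<open>C i\<close> and \<open>C j\<close>. The \<open>C i\<close>, \<open>C j\<close> block of the adjacency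
  matrix of \<open>C k\<close> is then \<open>1\<close> at every pair of distinct elements and \<open>0\<close> on the diagonal. If
  there is no such pair, then \<open>C i = C j\<close> is a singleton, whose identity is its all-ones block.\<close>
lemma block_ones_mem_subalgebra:
  assumes B: "subring B (matrix_algebra (carrier G))" "cmat.subspace B"
    and adj: "\<And>k. k \<in> I \<Longrightarrow> adj_matrix G (C k) \<in> B"
    and dual: "\<And>k. k \<in> I \<Longrightarrow> dual_idempotent (C k) \<in> B"
    and ij: "i \<in> I" "j \<in> I"
  shows "block_ones (C i) (C j) \<in> B"
proof (cases "\<exists>x\<in>C i. \<exists>y\<in>C j. x \<noteq> y")
  case True
  then obtain x y where xy: "x \<in> C i" "y \<in> C j" "x \<noteq> y" by blast
  then have "y \<otimes> inv x \<in> carrier G" using part_closed ij by simp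
  then obtain k where k: "k \<in> I" "y \<otimes> inv x \<in> C k" using idx_in by blast
  have one: "\<one> \<notin> C k"
    using k xy ij part_closed quotient_one_iff[of x y] conjugacy_class_of_one[of "C k"] classes by blast
  define M where "M = mat_mult (carrier G) (dual_idempotent (C i)) (mat_mult (carrier G) (adj_matrix G (C k)) (dual_idempotent (C j)))"
  have M_apply: "M x' y' = (if x' \<in> C i \<and> y' \<in> C j \<and> x' \<noteq> y' then 1 else 0)" for x' y'
  proof -
    have "M x' y' = (if x' \<in> C i \<and> y' \<in> C j then adj_matrix G (C k) x' y' else 0)"
      unfolding M_def using ij part_closed finite_X by (subst mat_mult_dual_idempotent) auto
    moreover have "y' \<otimes> inv x' \<in> C k \<longleftrightarrow> x' \<noteq> y'" if "x' \<in> C i" "y' \<in> C j"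
      using that quotient_class[OF ij k(1) xy(1) that(1) xy(2) that(2) xy(3) _ k(2)] one part_closed[OF ij(1)]
      by auto
    ultimately show ?thesis using ij part_closed by (auto simp: adj_matrix_def)
  qed
  have "M \<in> B"
    using subringE(6)[OF B(1)] adj[OF k(1)] dual ij by (simp add: M_def matrix_algebra_simps)
  moreover have "block_ones (C i) (C j) = M + (if i = j then dual_idempotent (C i) else 0)"
  proof (intro ext)
    fix x' y'
    show "block_ones (C i) (C j) x' y' = (M + (if i = j then dual_idempotent (C i) else 0)) x' y'"
    proof (cases "i = j")
      case False
      then have "C i \<inter> C j = {}"
        using disjoint_parts ij by (simp add: disjoint_family_on_def)
      then show ?thesis
        using False by (auto simp: M_apply block_ones_def)
    qed (auto simp: M_apply block_ones_def dual_idempotent_def)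
  qed
  ultimately show ?thesis
    using dual[OF ij(1)] cmat.subspace_add[OF B(2)] by (cases "i = j") auto
next
  case False
  then have "block_ones (C i) (C j) = dual_idempotent (C i)"
  proof -
    obtain u v where uv: "u \<in> C i" "v \<in> C j"
      using card_part_pos ij by (metis card_gt_0_iff ex_in_conv)
    have eq: "x = y" if "x \<in> C i" "y \<in> C j" for x y
      using False that by blast
    have "C i \<subseteq> {v}" "C j \<subseteq> {u}"
      using eq[OF _ uv(2)] eq[OF uv(1)] by blast+
    then have "C i = {u}" "C j = {u}" using uv eq[OF uv] by blast+
    then show ?thesis by (auto simp: fun_eq_iff block_ones_def dual_idempotent_def)
  qed
  then show ?thesis using dual[OF ij(1)] by simp
qed

theorem terwilliger_algebra_eq: "terwilliger_algebra G = block_algebra"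
proof -
  let ?S = "adj_matrix G ` conjugacy_classes G \<union> dual_idempotent ` conjugacy_classes G"
  let ?F = "{B. subring B (matrix_algebra (carrier G)) \<and> cmat.subspace B \<and> ?S \<subseteq> B}"
  have "block_matrices \<in> ?F"
    using subring_block_matrices subspace_block_matrices adj_matrix_block_matrix
    by (auto simp: classes[symmetric] dual_idempotent_eq)
  moreover have "block_matrices \<subseteq> B" if "B \<in> ?F" for B
  proof
    fix M assume "M \<in> block_matrices"
    then obtain a b where M: "M = block_matrix a b" by (rule block_matricesE)
    have B: "subring B (matrix_algebra (carrier G))" "cmat.subspace B"
      and dual: "\<And>k. k \<in> I \<Longrightarrow> dual_idempotent (C k) \<in> B"
      and adj: "\<And>k. k \<in> I \<Longrightarrow> adj_matrix G (C k) \<in> B"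
      using that unfolding classes[symmetric] by auto
    show "M \<in> B"
      unfolding M using B dual block_ones_mem_subalgebra[OF B adj dual]
      by (intro block_matrix_mem_subspace) auto
  qed
  ultimately have "\<Inter>?F = block_matrices"
    by (intro equalityI Inter_lower Inter_greatest)
  then show ?thesis
    unfolding terwilliger_algebra_def generated_subalgebra_def by simp
qed

lemma card_conjugacy_classes: "card (conjugacy_classes G) = card I"
proof -
  have "inj_on C I"
  proof (rule inj_onI)
    fix i j assume ij: "i \<in> I" "j \<in> I" "C i = C j"
    obtain x where "x \<in> C i" using card_part_pos[OF ij(1)] by fastforce
    then show "i = j" using ij idx_eq by metis
  qed
  then show ?thesis using card_image classes by metis
qed

lemma constant_blocks_primary: "is_primary_component G constant_blocks"
proof -
  have min: "minimal_ideal constant_blocks (terwilliger_algebra G)"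
    using wedderburn_block_algebra base_index
    by (auto simp: terwilliger_algebra_eq wedderburn_decomposition_def bij_betw_def component_def)
  let ?v = "mat_vec (carrier G) (adj_matrix G (C i0)) (std_basis \<one>)"
  have "?v \<in> primary_module G"
    unfolding primary_module_def classes[symmetric]
    using base_index by (intro imageI cmat.span_base) auto
  moreover have "mat_vec (carrier G) (block_ones (C i0) (C i0)) ?v \<noteq> 0"
  proof -
    have "?v \<one> = 1"
      using finite_X by (simp add: mat_vec_def std_basis_def adj_matrix_def base_class if_distrib cong: if_cong)
    moreover have "mat_vec (carrier G) (block_ones (C i0) (C i0)) ?v \<one> = (\<Sum>y\<in>carrier G. if y = \<one> then ?v \<one> else 0)"
      unfolding mat_vec_def[of _ "block_ones (C i0) (C i0)"]
      by (intro sum.cong) (auto simp: block_ones_def base_class)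
    ultimately have "mat_vec (carrier G) (block_ones (C i0) (C i0)) ?v \<one> = 1"
      using finite_X by simp
    then show ?thesis by (metis zero_fun_apply zero_neq_one)
  qed
  moreover have "block_ones (C i0) (C i0) \<in> constant_blocks"
    by (simp add: block_ones_eq base_index)
  ultimately show ?thesis
    unfolding is_primary_component_def
    using min dim_constant_blocks card_conjugacy_classes by auto
qed

text \<open>The other minimal ideals have dimension at most \<open>1\<close>, while the square of the number of classes is at least \<open>4\<close> as
  soon as another minimal ideal exists.\<close>
theorem primary_component_iff: "is_primary_component G U \<longleftrightarrow> U = constant_blocks"
proof
  assume U: "is_primary_component G U"
  then have "U \<in> component ` I"
    using wedderburn_block_algebra
    by (auto simp: is_primary_component_def terwilliger_algebra_eq wedderburn_decomposition_def bij_betw_def)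
  then obtain i where i: "i \<in> I" "U = component i" by blast
  show "U = constant_blocks"
  proof (cases "i = i0")
    case False
    have "card {i, i0} \<le> card I"
      using i base_index finite_index by (intro card_mono) auto
    then have "2\<^sup>2 \<le> (card I)\<^sup>2"
      using False by (intro power_mono) auto
    moreover have "cmat.dim U \<le> 1"
      using i False cmat.dim_le_card[of U "{class_matrix (C i)}"] by (simp add: component_def)
    ultimately show ?thesis
      using U card_conjugacy_classes by (simp add: is_primary_component_def)
  qed (use i in \<open>simp add: component_def\<close>)
qed (use constant_blocks_primary in simp)

end

text \<open>A homomorphism \<open>\<phi>\<close> to an abelian group is constant on classes. If each fibre meets at most one non-identity
  class, then \<open>\<phi> y\<close> and \<open>\<phi> x\<close> determine the class of \<open>y \<otimes> inv x\<close> whenever this quotient is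
  not \<open>\<one>\<close>. Triviality of the centre means that non-identity classes have at least two elements.\<close>
lemma class_partitionI:
  fixes G (structure)
  assumes "group G" and fin: "finite (carrier G)"
    and C: "bij_betw C I (conjugacy_classes G)" and i0: "i0 \<in> I" "C i0 = {\<one>\<^bsub>G\<^esub>}"
    and centre: "\<And>z. z \<in> carrier G \<Longrightarrow> (\<And>g. g \<in> carrier G \<Longrightarrow> g \<otimes>\<^bsub>G\<^esub> z = z \<otimes>\<^bsub>G\<^esub> g) \<Longrightarrow> z = \<one>\<^bsub>G\<^esub>"
    and A: "comm_group A" and hom: "\<phi> \<in> hom G A"
    and fibre: "\<And>x y. \<lbrakk>x \<in> carrier G; y \<in> carrier G; x \<noteq> \<one>\<^bsub>G\<^esub>; y \<noteq> \<one>\<^bsub>G\<^esub>; \<phi> x = \<phi> y\<rbrakk>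
      \<Longrightarrow> \<exists>g\<in>carrier G. y = g \<otimes>\<^bsub>G\<^esub> x \<otimes>\<^bsub>G\<^esub> inv\<^bsub>G\<^esub> g"
  shows "class_partition G I C i0"
proof -
  interpret group G by fact
  interpret A: comm_group A by fact
  interpret \<phi>: group_hom G A \<phi>
    using hom by unfold_locales
  have classes: "C ` I = conjugacy_classes G" and inj: "inj_on C I"
    using C by (auto simp: bij_betw_def)
  have C_mem: "C i \<in> conjugacy_classes G" if "i \<in> I" for i
    using classes that by blast
  have C_closed: "x \<in> carrier G" if "i \<in> I" "x \<in> C i" for i x
    using Union_conjugacy_classes C_mem that by blast
  have union: "(\<Union>i\<in>I. C i) = carrier G"
    using Union_conjugacy_classes classes by simp
  have disj: "disjoint_family_on C I"
    unfolding disjoint_family_on_def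
    using conjugacy_classes_disjoint[OF C_mem C_mem] inj by (meson inj_onD)
  have \<phi>_class: "\<phi> x = \<phi> y" if i: "i \<in> I" and x: "x \<in> C i" and y: "y \<in> C i" for i x y
  proof -
    obtain g where g: "g \<in> carrier G" "y = g \<otimes> x \<otimes> inv g"
      using conjugacy_class_eq[OF C_mem[OF i] x] y by blast
    then have "\<phi> y = \<phi> g \<otimes>\<^bsub>A\<^esub> \<phi> x \<otimes>\<^bsub>A\<^esub> inv\<^bsub>A\<^esub> \<phi> g"
      using C_closed[OF i x] by simp
    also have "\<dots> = \<phi> x"
      using C_closed[OF i x] g(1) A.m_comm[of "\<phi> g" "\<phi> x"] by (simp add: A.m_assoc)
    finally show ?thesis by simp
  qed
  have card_C: "card (C i) \<ge> 2" if i: "i \<in> I" "i \<noteq> i0" for i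
  proof -
    have "C i \<in> conjugacy_classes G" using C_mem i by blast
    then obtain z where z: "z \<in> C i" "z \<in> carrier G"
      unfolding conjugacy_classes_def orbits_def
      using group_action.orbit_refl[OF conjugation_action] by blast
    have "z \<noteq> \<one>"
      using conjugacy_class_of_one[OF C_mem[OF i(1)]] i0 inj i z by (metis inj_onD)
    then obtain g where g: "g \<in> carrier G" "g \<otimes> z \<noteq> z \<otimes> g"
      using centre z by blast
    have "g \<otimes> z \<otimes> inv g \<noteq> z"
      using g z by (metis inv_solve_right m_closed)
    moreover have "g \<otimes> z \<otimes> inv g \<in> C i"
      using conjugate_mem_class[OF C_mem z(1) g(1)] i by blast
    moreover have "finite (C i)"
      using fin C_closed i by (meson finite_subset subsetI)
    ultimately show ?thesis
      using z card_mono[of "C i" "{z, g \<otimes> z \<otimes> inv g}"] by auto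
  qed
  have quot: "y' \<otimes> inv x' \<in> C k"
    if ijk: "i \<in> I" "j \<in> I" "k \<in> I" and x: "x \<in> C i" "x' \<in> C i" and y: "y \<in> C j" "y' \<in> C j"
      and neq: "x \<noteq> y" "x' \<noteq> y'" and k: "y \<otimes> inv x \<in> C k" for i j k x y x' y'
  proof -
    have cl: "x \<in> carrier G" "x' \<in> carrier G" "y \<in> carrier G" "y' \<in> carrier G"
      using C_closed ijk x y by blast+
    have "y \<otimes> inv x \<noteq> \<one>" "y' \<otimes> inv x' \<noteq> \<one>"
      using neq cl by (metis inv_closed inv_equality inv_inv)+
    moreover have "\<phi> (y \<otimes> inv x) = \<phi> (y' \<otimes> inv x')"
      using cl \<phi>_class[OF ijk(1) x] \<phi>_class[OF ijk(2) y] by simp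
    ultimately obtain g where "g \<in> carrier G" "y' \<otimes> inv x' = g \<otimes> (y \<otimes> inv x) \<otimes> inv g"
      using fibre[of "y \<otimes> inv x" "y' \<otimes> inv x'"] cl by auto
    then show ?thesis
      using conjugate_mem_class[OF C_mem[OF ijk(3)] k] by simp
  qed
  have "finite (C ` I)"
    using fin union by (intro finite_UnionD) simp
  then have "finite I"
    using inj by (rule finite_imageD)
  then have part: "based_partition (carrier G) I C i0"
    using i0 disj union card_C by (simp add: based_partition_def)
  show ?thesis
    by (intro class_partition.intro class_partition_axioms.intro group_axioms part classes i0(2)) (rule quot)
qed

section \<open>Frobenius groups with a complement as large as the kernel allows\<close>

text \<open>Since \<open>H\<close> acts freely on \<open>N - {\<one>}\<close>, its order is at most \<open>card N - 1\<close>; \<open>card_kernel\<close> says that this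
  bound is attained.\<close>
locale abelian_complement_frobenius = group G for G (structure) +
  fixes N H
  assumes finite_carrier: "finite (carrier G)"
    and complement: "frobenius_complement G H"
    and semidirect: "internal_semidirect_product G N H"
    and commute: "\<And>h k. h \<in> H \<Longrightarrow> k \<in> H \<Longrightarrow> h \<otimes> k = k \<otimes> h"
    and card_kernel: "card N = card H + 1"
begin

lemma normal_N: "N \<lhd> G" and subgroup_H: "subgroup H G"
  and N_Int_H: "N \<inter> H = {\<one>}" and N_H: "N <#> H = carrier G"
  using semidirect unfolding internal_semidirect_product_def by auto

sublocale N: normal N G by (rule normal_N)
sublocale H: subgroup H G by (rule subgroup_H)

text \<open>If \<open>g\<close> commutes with \<open>h\<close>, then \<open>h\<close> lies both in \<open>H\<close> and in its conjugate by \<open>g\<close>.\<close>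
lemma centralizer_subset_complement:
  assumes h: "h \<in> H" "h \<noteq> \<one>" and g: "g \<in> carrier G" "g \<otimes> h = h \<otimes> g"
  shows "g \<in> H"
proof (rule ccontr)
  assume "g \<notin> H"
  then have "H \<inter> conj_set G g H = {\<one>}"
    using complement g unfolding frobenius_complement_def by blast
  moreover have "g \<otimes> h \<otimes> inv g = h"
    using g h by (simp add: m_assoc)
  then have "h \<in> conj_set G g H"
    unfolding conj_set_def using h by (metis image_eqI)
  ultimately show False using h by blast
qed

text \<open>A central \<open>z \<noteq> \<one>\<close> commutes with a non-identity element of \<open>H\<close>, so it lies in \<open>H\<close>; but then everything commutes
  with a non-identity element of \<open>H\<close>, and \<open>H\<close> would be the whole group.\<close>
lemma centre_trivial:
  assumes z: "z \<in> carrier G" and comm: "\<And>g. g \<in> carrier G \<Longrightarrow> g \<otimes> z = z \<otimes> g"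
  shows "z = \<one>"
proof (rule ccontr)
  assume "z \<noteq> \<one>"
  obtain h where h: "h \<in> H" "h \<noteq> \<one>"
    using complement H.one_closed unfolding frobenius_complement_def by blast
  have "z \<in> H"
    using centralizer_subset_complement[OF h z] comm[of h] h by simp
  then have "carrier G \<subseteq> H"
    using centralizer_subset_complement[of z] \<open>z \<noteq> \<one>\<close> comm by blast
  then show False
    using complement H.subset unfolding frobenius_complement_def by blast
qed

lemma coset_of_complement:
  assumes "x \<in> carrier G" obtains h where "h \<in> H" "x \<in> N #> h" "N #> x = N #> h"
proof -
  obtain n h where nh: "n \<in> N" "h \<in> H" "x = n \<otimes> h"
    using N_H assms unfolding set_mult_def by blast
  then have "x \<in> N #> h" by (auto simp: r_coset_def)
  then show ?thesis
    using that nh repr_independence[of x N h] N.subgroup_axioms by auto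
qed

lemma comm_group_quotient: "comm_group (G Mod N)"
proof (rule group.group_comm_groupI[OF N.factorgroup_is_group])
  fix c d assume "c \<in> carrier (G Mod N)" "d \<in> carrier (G Mod N)"
  then obtain x y where "x \<in> carrier G" "c = N #> x" "y \<in> carrier G" "d = N #> y"
    unfolding FactGroup_def RCOSETS_def by auto
  then obtain h k where "h \<in> H" "c = N #> h" "k \<in> H" "d = N #> k"
    by (metis coset_of_complement)
  then show "c \<otimes>\<^bsub>G Mod N\<^esub> d = d \<otimes>\<^bsub>G Mod N\<^esub> c"
    by (simp add: N.rcos_sum commute)
qed

text \<open>If \<open>s\<close> and \<open>t\<close> conjugate \<open>x\<close> to the same element, then \<open>inv t \<otimes> s\<close> centralizes \<open>x\<close>.\<close>
lemma conjugation_inj: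
  assumes x: "x \<in> carrier G" and S: "subgroup S G"
    and free: "\<And>s. s \<in> S \<Longrightarrow> s \<otimes> x = x \<otimes> s \<Longrightarrow> s = \<one>"
  shows "inj_on (\<lambda>s. s \<otimes> x \<otimes> inv s) S"
proof (rule inj_onI)
  interpret S: subgroup S G by fact
  fix s t assume st: "s \<in> S" "t \<in> S" "s \<otimes> x \<otimes> inv s = t \<otimes> x \<otimes> inv t"
  have "inv t \<otimes> s \<otimes> x = inv t \<otimes> (s \<otimes> x \<otimes> inv s) \<otimes> s"
    using st(1,2) x by (simp add: m_assoc)
  also have "\<dots> = x \<otimes> (inv t \<otimes> s)"
    unfolding st(3) using st(1,2) x by (simp add: m_assoc inv_cancel_left)
  finally have "inv t \<otimes> s \<otimes> x = x \<otimes> (inv t \<otimes> s)" .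
  then have "inv t \<otimes> s = \<one>"
    using free[of "inv t \<otimes> s"] st by simp
  then show "s = t"
    using st by (metis S.mem_carrier inv_closed inv_equality inv_inv)
qed

text \<open>The conjugates by elements of \<open>N\<close> stay in the coset, and they are pairwise distinct because the
  centralizer of \<open>h\<close> lies in \<open>H\<close> and meets \<open>N\<close> trivially. So there are as many of them as
  elements of the coset.\<close>
lemma kernel_conjugates_eq_coset:
  assumes h: "h \<in> H" "h \<noteq> \<one>"
  shows "(\<lambda>n. n \<otimes> h \<otimes> inv n) ` N = N #> h"
proof (rule card_subset_eq)
  show "finite (N #> h)"
    using finite_carrier N.subset by (auto simp: r_coset_def intro: finite_subset)
  show "(\<lambda>n. n \<otimes> h \<otimes> inv n) ` N \<subseteq> N #> h"
  proof clarify
    fix n assume n: "n \<in> N"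
    have "n \<otimes> h \<otimes> inv n = n \<otimes> (h \<otimes> inv n \<otimes> inv h) \<otimes> h"
      using n h by (simp add: m_assoc)
    moreover have "n \<otimes> (h \<otimes> inv n \<otimes> inv h) \<in> N"
      using n h N.inv_op_closed2 by simp
    ultimately show "n \<otimes> h \<otimes> inv n \<in> N #> h"
      unfolding r_coset_def by auto
  qed
  have "inj_on (\<lambda>n. n \<otimes> h \<otimes> inv n) N"
    using h N_Int_H centralizer_subset_complement[OF h]
    by (intro conjugation_inj N.subgroup_axioms) auto
  then have "card ((\<lambda>n. n \<otimes> h \<otimes> inv n) ` N) = card N"
    by (rule card_image)
  also have "\<dots> = card (N #> h)"
    using card_rcosets_equal[OF rcosetsI N.subset] h N.subset by simp
  finally show "card ((\<lambda>n. n \<otimes> h \<otimes> inv n) ` N) = card (N #> h)" .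
qed

text \<open>Here an element \<open>s \<noteq> \<one>\<close> of \<open>H\<close> that fixes \<open>x\<close> would force \<open>x \<in> H\<close>, so the conjugates are distinct, and
  \<open>card H\<close> many of them fill \<open>N - {\<one>}\<close>.\<close>
lemma complement_conjugates_eq_kernel:
  assumes x: "x \<in> N" "x \<noteq> \<one>"
  shows "(\<lambda>h. h \<otimes> x \<otimes> inv h) ` H = N - {\<one>}"
proof (rule card_subset_eq)
  show "finite (N - {\<one>})"
    using finite_carrier N.subset by (auto intro: finite_subset)
  show "(\<lambda>h. h \<otimes> x \<otimes> inv h) ` H \<subseteq> N - {\<one>}"
  proof clarify
    fix h assume h: "h \<in> H"
    have "h \<otimes> x \<otimes> inv h \<noteq> \<one>"
      using x h by (metis H.mem_carrier N.mem_carrier inv_closed inv_equality inv_inv l_cancel_one' m_closed r_cancel_one r_inv)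
    then show "h \<otimes> x \<otimes> inv h \<in> N - {\<one>}"
      using x h N.inv_op_closed2 by simp
  qed
  have "inj_on (\<lambda>h. h \<otimes> x \<otimes> inv h) H"
  proof (intro conjugation_inj H.subgroup_axioms)
    fix s assume s: "s \<in> H" "s \<otimes> x = x \<otimes> s"
    show "s = \<one>"
      using centralizer_subset_complement[OF s(1), of x] s x N_Int_H by auto
  qed (use x in simp)
  then have "card ((\<lambda>h. h \<otimes> x \<otimes> inv h) ` H) = card H"
    by (rule card_image)
  also have "\<dots> = card (N - {\<one>})"
    using card_kernel by (simp add: card_Diff_singleton)
  finally show "card ((\<lambda>h. h \<otimes> x \<otimes> inv h) ` H) = card (N - {\<one>})" .
qed

text \<open>The coset is either \<open>N\<close> itself or the coset of some \<open>h \<noteq> \<one>\<close> in \<open>H\<close>; the two preceding counts cover these cases.\<close>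
lemma conjugate_in_coset:
  assumes x: "x \<in> carrier G" "x \<noteq> \<one>" and y: "y \<in> carrier G" "y \<noteq> \<one>"
    and eq: "N #> x = N #> y"
  shows "\<exists>g\<in>carrier G. y = g \<otimes> x \<otimes> inv g"
proof -
  obtain h where h: "h \<in> H" "x \<in> N #> h" "N #> x = N #> h"
    using coset_of_complement[OF x(1)] by blast
  then have y_coset: "y \<in> N #> h"
    using eq y rcos_self[OF y(1) N.subgroup_axioms] by simp
  show ?thesis
  proof (cases "h = \<one>")
    case True
    then have "x \<in> N" "y \<in> N"
      using h y_coset by (simp_all add: coset_mult_one[OF N.subset])
    then have "y \<in> (\<lambda>h. h \<otimes> x \<otimes> inv h) ` H"
      using x y complement_conjugates_eq_kernel by blast
    then show ?thesis by auto
  next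
    case False
    obtain m n where m: "m \<in> N" "x = m \<otimes> h \<otimes> inv m" and n: "n \<in> N" "y = n \<otimes> h \<otimes> inv n"
      using kernel_conjugates_eq_coset[OF h(1) False] h(2) y_coset by blast
    have "y = (n \<otimes> inv m) \<otimes> x \<otimes> inv (n \<otimes> inv m)"
      unfolding m(2) n(2) using m(1) n(1) h(1) by (intro conjugate_of_conjugates) simp_all
    then show ?thesis
      by (rule bexI) (use m(1) n(1) in simp)
  qed
qed

lemma class_partition_of_classes:
  assumes "bij_betw C I (conjugacy_classes G)" "i0 \<in> I" "C i0 = {\<one>}"
  shows "class_partition G I C i0"
  using centre_trivial conjugate_in_coset
  by (intro class_partitionI[OF group_axioms finite_carrier assms _ comm_group_quotient N.r_coset_hom_Mod]) auto

end

section \<open>Elementary abelian kernels and cyclic complements\<close>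
lemma card_integer_mod_group: "n > 0 \<Longrightarrow> card (carrier (integer_mod_group n)) = n"
  by (simp add: carrier_integer_mod_group)

lemma card_iso_product_group:
  assumes "G\<lparr>carrier := N\<rparr> \<cong> product_group {..<r} (\<lambda>_. integer_mod_group p)" "p > 0"
  shows "card N = p ^ r"
proof -
  have "card N = card (\<Pi>\<^sub>E i\<in>{..<r}. {0..<int p})"
    using iso_same_card[OF assms(1)] assms(2) by (simp add: carrier_integer_mod_group)
  then show ?thesis by (simp add: card_PiE)
qed

theorem theorem5p12:
  fixes G :: "('a, 'b) monoid_scheme"
    and N H :: "'a set"
    and p r :: nat
    and C :: "nat \<Rightarrow> 'a set"
  assumes "prime p" and "r \<ge> 1"
    and "frobenius_group G N H"
    and "G\<lparr>carrier := N\<rparr> \<cong> product_group {..<r} (\<lambda>_. integer_mod_group p)"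
    and "G\<lparr>carrier := H\<rparr> \<cong> integer_mod_group (p ^ r - 1)"
    and "bij_betw C {0..p ^ r - 1} (conjugacy_classes G)"
    and "C 0 = {\<one>\<^bsub>G\<^esub>}"
  shows "\<exists>V. (\<forall>U. is_primary_component G U \<longleftrightarrow> U = V) \<and>
             wedderburn_decomposition (terwilliger_algebra G) {0..p ^ r - 1}
               (\<lambda>i. if i = 0 then V else cmat.span {class_matrix (C i)})"
proof -
  have "p ^ r > 1"
    using one_less_power[of p r] prime_gt_1_nat[OF assms(1)] assms(2) by simp
  interpret group G
    using assms(3) by (simp add: frobenius_group_def)
  have frob: "finite (carrier G)" "frobenius_complement G H" "internal_semidirect_product G N H"
    using assms(3) unfolding frobenius_group_def by blast+
  interpret H: subgroup H G
    using frob(2) by (simp add: frobenius_complement_def)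
  have card_N: "card N = p ^ r"
    using card_iso_product_group[OF assms(4)] prime_gt_0_nat[OF assms(1)] by blast
  have card_H: "card H = p ^ r - 1"
    using iso_same_card[OF assms(5)] card_integer_mod_group[of "p ^ r - 1"] \<open>p ^ r > 1\<close> by simp
  have "comm_group (G\<lparr>carrier := H\<rparr>)"
    using comm_group.iso_imp_comm_group[of "integer_mod_group (p ^ r - 1)" "G\<lparr>carrier := H\<rparr>"]
      abelian_integer_mod_group assms(5) H.subgroup_is_group[OF group_axioms]
      group.iso_sym by (metis group.is_monoid)
  then have comm: "h \<otimes>\<^bsub>G\<^esub> k = k \<otimes>\<^bsub>G\<^esub> h" if "h \<in> H" "k \<in> H" for h k
    using comm_groupE(4) that by fastforce
  interpret abelian_complement_frobenius G N H
    using frob comm card_N card_H \<open>p ^ r > 1\<close> by unfold_locales auto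
  interpret class_partition G "{0..p ^ r - 1}" C 0
    using assms(6,7) by (intro class_partition_of_classes) auto
  have component: "component = (\<lambda>i. if i = 0 then constant_blocks else cmat.span {class_matrix (C i)})"
    by (intro ext) (rule component_def)
  have "wedderburn_decomposition (terwilliger_algebra G) {0..p ^ r - 1}
      (\<lambda>i. if i = 0 then constant_blocks else cmat.span {class_matrix (C i)})"
    using wedderburn_block_algebra unfolding terwilliger_algebra_eq component .
  then show ?thesis
    using primary_component_iff by blast
qed

end
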